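(* Let $\alpha$ be a real number not in $\mathbb{Q}(\mathbf{H}_4)$. Let $\frac{r_i}{s_i}$ be the $i$-th convergent of the Rosen continued fraction of $\alpha$ and let $\frac{\tilde r_i}{\tilde s_i}$ be the $i$-th convergent of the dual Rosen continued fraction of $\alpha$. Then $p/q\in\mathbb{Q}(\mathbf{H}_4)$ is an $\mathbf{H}_4$-best approximation of $\alpha$ if and only if $$\frac pq=\frac{r_i}{s_i}\ \text{ for some } i\ge0\qquad\text{or}\qquad \frac pq=\frac{\tilde r_i}{\tilde s_i}\ \text{ for some } i\ge1.$$
   Context: The Hecke group $\mathbf{H}_4$ is the subgroup of $\mathrm{PSL}_2(\mathbb{R})$ generated by $\begin{pmatrix}1&\sqrt2\\0&1\end{pmatrix}$ and $\begin{pmatrix}0&-1\\1&0\end{pmatrix}$. The set $\mathbb{Q}(\mathbf{H}_4)\subset \mathbb{R}\cup\{\infty\}$ is the set of all $p/q$ such that $\begin{pmatrix} p & r \\ q & s \end{pmatrix}\in\mathbf{H}_4$ for some $r,s$; its finite elements form the set $\sqrt2\,\mathbb{Q}$. Writing $p/q\in\mathbb{Q}(\mathbf{H}_4)$ always means the normalized form: $(p,q)$ is the first column of a matrix in $\mathbf{H}_4$ with $q>0$. Explicitly, either $p=a$, $q=\sqrt2\,c$ with $a,c\in\mathbb{Z}$, $c>0$, $\gcd(a,2c)=1$, or $p=\sqrt2\,a$, $q=c$ with $a,c\in\mathbb{Z}$, $c>0$, $\gcd(2a,c)=1$. $p/q\in\mathbb{Q}(\mathbf{H}_4)$ is an $\mathbf{H}_4$-best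 approximation of a real number $\alpha$ if for any $r/s\in\mathbb{Q}(\mathbf{H}_4)$ with $r/s\ne p/q$ and $0<s\le q$ one has $|s\alpha-r|>|q\alpha-p|$. Notation: for $a_0\in\mathbb{Z}$, $a_i\in\mathbb{N}$ (positive integers) and $\epsilon_i\in\{-1,+1\}$ ($i\ge1$), $$\llbracket a_0;\epsilon_1/a_1,\epsilon_2/a_2,\dots\rrbracket = a_0\sqrt2+\cfrac{\epsilon_1}{a_1\sqrt2+\cfrac{\epsilon_2}{a_2\sqrt2+\ddots}},$$ and $\llbracket a_0;\epsilon_1/a_1,\dots,\epsilon_i/a_i\rrbracket$ is the corresponding finite expression, called the $i$-th convergent. Rosen continued fraction of $\alpha\in\mathbb{R}\setminus\mathbb{Q}(\mathbf{H}_4)$: the expansion $\alpha=\llbracket a_0;\epsilon_1/a_1,\epsilon_2/a_2,\dots\rrbracket$ with the rule that if $a_i=1$ with $i\ge1$ then $\epsilon_{i+1}=+1$. It is generated as follows: put $x_0=\alpha$; given $x_i$, let $a_i$ be the integer with $a_i\sqrt2-\frac1{\sqrt2}<x_i<a_i\sqrt2+\frac1{\sqrt2}$, let $\epsilon_{i+1}$ be the sign of $x_i-a_i\sqrt2$, and let $x_{i+1}=1/|x_i-a_i\sqrt2|$. Its $i$-th convergent is $\frac{r_i}{s_i}=\llbracket a_0;\epsilon_1/a_1,\dots,\epsilon_i/a_i\rrbracket$. Dual Rosen continued fraction of $\alpha$: the expansion $\alpha=\llbracket\tilde a_0;\tilde\epsilon_1/\tilde a_1,\tilde\epsilon_2/\tilde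 a_2,\dots\rrbracket$ with the rule that if $\tilde a_i=1$ with $i\ge1$ then $\tilde\epsilon_i=+1$. It is generated as follows: put $x_0=\alpha$; given $x_i$, let $\tilde a_i$ be the integer with $(\tilde a_i-1)\sqrt2+1\le x_i<\tilde a_i\sqrt2+1$, let $\tilde\epsilon_{i+1}$ be the sign of $x_i-\tilde a_i\sqrt2$, and let $x_{i+1}=1/|x_i-\tilde a_i\sqrt2|$. Its $i$-th convergent is $\frac{\tilde r_i}{\tilde s_i}=\llbracket\tilde a_0;\tilde\epsilon_1/\tilde a_1,\dots,\tilde\epsilon_i/\tilde a_i\rrbracket$. *)

theory Defs
  imports "HOL-Analysis.Determinants" "HOL-Library.Extended_Real" "HOL-Algebra.Generated_Groups"
begin

section \<open>The Hecke group of index 4\<close>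

definition SL2 :: "(real^2^2) monoid" where
  "SL2 = \<lparr>carrier = {A. det A = 1}, mult = (**), one = mat 1\<rparr>"

definition SL2_center :: "(real^2^2) set" where
  "SL2_center = {mat 1, - mat 1}"

definition PSL2 :: "(real^2^2) set monoid" where
  "PSL2 = SL2 Mod SL2_center"

definition PSL2_class :: "real^2^2 \<Rightarrow> (real^2^2) set" where
  "PSL2_class A = SL2_center #>\<^bsub>SL2\<^esub> A"

definition mat2 :: "real \<Rightarrow> real \<Rightarrow> real \<Rightarrow> real \<Rightarrow> real^2^2" where
  "mat2 a b c d = vector [vector [a, b], vector [c, d]]"

definition H4 :: "(real^2^2) set set" where
  "H4 = generate PSL2 {PSL2_class (mat2 1 (sqrt 2) 0 1), PSL2_class (mat2 0 (-1) 1 0)}"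

definition H4_column :: "real \<Rightarrow> real \<Rightarrow> bool" where
  "H4_column p q \<longleftrightarrow> (\<exists>r s. mat2 p r q s \<in> carrier SL2 \<and> PSL2_class (mat2 p r q s) \<in> H4)"

text \<open>
  The extended real line with its single point at infinity is represented inside \<^typ>\<open>ereal\<close>;
  the value \<open>-\<infinity>\<close> is never used.
\<close>
definition Q_H4 :: "ereal set" where
  "Q_H4 = {if q = 0 then \<infinity> else ereal (p / q) | p q. H4_column p q}"

text \<open>
  A finite element of \<^const>\<open>Q_H4\<close> is handled through its normalized form \<open>p/q\<close>: the pair
  \<open>(p, q)\<close> carries information beyond the real number \<open>p / q\<close>, because \<open>q\<close> is its
  denominator.
\<close>
definition H4_fraction :: "real \<Rightarrow> real \<Rightarrow> bool" where
  "H4_fraction p q \<longleftrightarrow> H4_column p q \<and> q > 0"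

definition H4_best_approximation :: "real \<Rightarrow> real \<Rightarrow> real \<Rightarrow> bool" where
  "H4_best_approximation \<alpha> p q \<longleftrightarrow>
     H4_fraction p q \<and>
     (\<forall>r s. H4_fraction r s \<and> r / s \<noteq> p / q \<and> 0 < s \<and> s \<le> q \<longrightarrow>
        \<bar>s * \<alpha> - r\<bar> > \<bar>q * \<alpha> - p\<bar>)"

section \<open>Continued fractions\<close>

text \<open>
  \<open>cfrac a \<epsilon> n\<close> is the finite expression
  \<open>a\<^sub>0 \<surd>2 + \<epsilon>\<^sub>1 / (a\<^sub>1 \<surd>2 + \<epsilon>\<^sub>2 / (\<dots> + \<epsilon>\<^sub>n / (a\<^sub>n \<surd>2)))\<close>; the value \<open>\<epsilon> 0\<close> is irrelevant.
  For the two expansions below all intermediate denominators are positive, so the convention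
  \<open>x / 0 = 0\<close> plays no role.
\<close>
primrec cfrac :: "(nat \<Rightarrow> int) \<Rightarrow> (nat \<Rightarrow> real) \<Rightarrow> nat \<Rightarrow> real" where
  "cfrac a \<epsilon> 0 = of_int (a 0) * sqrt 2"
| "cfrac a \<epsilon> (Suc n) =
     of_int (a 0) * sqrt 2 + \<epsilon> 1 / cfrac (\<lambda>i. a (Suc i)) (\<lambda>i. \<epsilon> (Suc i)) n"

text \<open>
  In both algorithms the digit \<open>a\<^sub>i\<close> is uniquely determined and \<open>x\<^sub>i - a\<^sub>i \<surd>2\<close> never vanishes
  when \<open>\<alpha>\<close> is not in \<^const>\<open>Q_H4\<close>. The signs \<open>\<epsilon>\<^sub>i\<close> are indexed from \<open>i = 1\<close>.
\<close>

definition rosen_digit :: "real \<Rightarrow> int" where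
  "rosen_digit x = (THE a. of_int a * sqrt 2 - 1 / sqrt 2 < x \<and> x < of_int a * sqrt 2 + 1 / sqrt 2)"

primrec rosen_x :: "real \<Rightarrow> nat \<Rightarrow> real" where
  "rosen_x \<alpha> 0 = \<alpha>"
| "rosen_x \<alpha> (Suc i) = 1 / \<bar>rosen_x \<alpha> i - of_int (rosen_digit (rosen_x \<alpha> i)) * sqrt 2\<bar>"

definition rosen_a :: "real \<Rightarrow> nat \<Rightarrow> int" where
  "rosen_a \<alpha> i = rosen_digit (rosen_x \<alpha> i)"

definition rosen_eps :: "real \<Rightarrow> nat \<Rightarrow> real" where
  "rosen_eps \<alpha> i = sgn (rosen_x \<alpha> (i - 1) - of_int (rosen_a \<alpha> (i - 1)) * sqrt 2)"

definition rosen_convergent :: "real \<Rightarrow> nat \<Rightarrow> real" where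
  "rosen_convergent \<alpha> i = cfrac (rosen_a \<alpha>) (rosen_eps \<alpha>) i"

definition dual_rosen_digit :: "real \<Rightarrow> int" where
  "dual_rosen_digit x = (THE a. (of_int a - 1) * sqrt 2 + 1 \<le> x \<and> x < of_int a * sqrt 2 + 1)"

primrec dual_rosen_x :: "real \<Rightarrow> nat \<Rightarrow> real" where
  "dual_rosen_x \<alpha> 0 = \<alpha>"
| "dual_rosen_x \<alpha> (Suc i) =
     1 / \<bar>dual_rosen_x \<alpha> i - of_int (dual_rosen_digit (dual_rosen_x \<alpha> i)) * sqrt 2\<bar>"

definition dual_rosen_a :: "real \<Rightarrow> nat \<Rightarrow> int" where
  "dual_rosen_a \<alpha> i = dual_rosen_digit (dual_rosen_x \<alpha> i)"

definition dual_rosen_eps :: "real \<Rightarrow> nat \<Rightarrow> real" where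
  "dual_rosen_eps \<alpha> i = sgn (dual_rosen_x \<alpha> (i - 1) - of_int (dual_rosen_a \<alpha> (i - 1)) * sqrt 2)"

definition dual_rosen_convergent :: "real \<Rightarrow> nat \<Rightarrow> real" where
  "dual_rosen_convergent \<alpha> i = cfrac (dual_rosen_a \<alpha>) (dual_rosen_eps \<alpha>) i"

end

theory Submission
  imports Defs
begin

text \<open>
  Two consecutive convergents form, up to a sign, a matrix of \<^const>\<open>H4\<close>, so every column of the group is
  a combination of them with one coefficient in \<open>\<int>\<close> and the other in \<open>\<surd>2 \<int>\<close>. Expressing
  denominators and errors in these coordinates reduces each question to small coefficients. Thus every
  Rosen convergent and every dual convergent of positive index is a best approximation, while a best
  approximation that is not a Rosen convergent is \<open>P\<^sub>k\<^sub>+\<^sub>1 - \<surd>2 P\<^sub>k\<close> for consecutive Rosen convergents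
  \<open>P\<close>, and one that is not a dual convergent is \<open>\<surd>2 Q\<^sub>j\<^sub>+\<^sub>1 - Q\<^sub>j\<close> for consecutive dual convergents \<open>Q\<close>.
  No column \<open>V\<close> has both shapes: the first one forces \<open>Q\<^sub>j\<^sub>+\<^sub>1\<close> to have a larger error than \<open>V\<close>, the second one
  forbids it.
\<close>

section \<open>Columns of the Hecke group\<close>

text \<open>The two expansions obey the same conditions with the complete quotient \<open>x\<close>
  and the ratio \<open>T / S\<close> of consecutive denominators exchanged. For Rosen,
  \<open>x > sqrt 2\<close> always, and \<open>T > (sqrt 2 + 1) * S\<close> when the sign is -1; for
  the dual, \<open>T \<ge> sqrt 2 * S\<close> always, and \<open>x \<ge> sqrt 2 + 1\<close> when the
  sign is -1. Hence the exceptional coefficients \<open>(- sqrt 2, 1)\<close> and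
  \<open>(-1, sqrt 2)\<close> mirror each other up to sign. Only the sign -1 is delicate: for +1
  either the denominators or the errors of the two basis columns add up without cancellation. The
  symmetry breaks at the ends of the digit intervals. The Rosen endpoints are cusps and never occur,
  but the dual one leads to \<open>x = sqrt 2 + 1\<close>, a fixed point of
  \<open>2 * sqrt 2 - 1 / x\<close> that is no cusp and does occur. There a competing column could
  have an equal error, and the denominators have to decide.\<close>

lemma mat2_eq_iff: "mat2 a b c d = mat2 a' b' c' d' \<longleftrightarrow> a = a' \<and> b = b' \<and> c = c' \<and> d = d'"
  by (auto simp: mat2_def vec_eq_iff forall_2)

lemma mat2_exhaust: obtains a b c d where "A = mat2 a b c d"
proof
  show "A = mat2 (A $ 1 $ 1) (A $ 1 $ 2) (A $ 2 $ 1) (A $ 2 $ 2)"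
    by (simp add: mat2_def vec_eq_iff forall_2)
qed

lemma mat2_mult: "mat2 a b c d ** mat2 a' b' c' d' =
    mat2 (a * a' + b * c') (a * b' + b * d') (c * a' + d * c') (c * b' + d * d')"
  by (simp add: mat2_def matrix_matrix_mult_def vec_eq_iff forall_2 sum_2)

lemma det_mat2: "det (mat2 a b c d) = a * d - b * c"
  by (simp add: mat2_def det_2)

lemma mat_1_eq_mat2: "mat 1 = mat2 1 0 0 1"
  by (simp add: mat2_def mat_def vec_eq_iff forall_2)

lemma uminus_mat2: "- mat2 a b c d = mat2 (- a) (- b) (- c) (- d)"
  by (simp add: mat2_def vec_eq_iff forall_2)

lemma mat2_in_SL2: "mat2 a b c d \<in> carrier SL2 \<longleftrightarrow> a * d - b * c = 1"
  by (simp add: SL2_def det_mat2)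

lemma SL2_simps: "mult SL2 = (**)" "one SL2 = mat2 1 0 0 1"
  by (simp_all add: SL2_def mat_1_eq_mat2)

lemma group_SL2: "group SL2"
proof (rule groupI)
  fix A assume A: "A \<in> carrier SL2"
  obtain a b c d where [simp]: "A = mat2 a b c d" by (rule mat2_exhaust)
  show "\<exists>B\<in>carrier SL2. B \<otimes>\<^bsub>SL2\<^esub> A = \<one>\<^bsub>SL2\<^esub>"
    using A by (intro bexI[of _ "mat2 d (-b) (-c) a"])
      (auto simp: SL2_simps mat2_mult mat2_in_SL2 mat2_eq_iff algebra_simps)
qed (auto simp: SL2_def det_mul matrix_mul_assoc)

lemma SL2_center_eq: "SL2_center = {mat2 1 0 0 1, mat2 (-1) 0 0 (-1)}"
  by (simp add: SL2_center_def mat_1_eq_mat2 uminus_mat2)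

lemma inv_SL2: 
  assumes "a * d - b * c = 1"
  shows "inv\<^bsub>SL2\<^esub> (mat2 a b c d) = mat2 d (-b) (-c) a"
proof (rule group.inv_equality[OF group_SL2])
  show "mat2 d (-b) (-c) a \<otimes>\<^bsub>SL2\<^esub> mat2 a b c d = \<one>\<^bsub>SL2\<^esub>"
    using assms by (auto simp: SL2_simps mat2_mult mat2_eq_iff algebra_simps)
qed (use assms in \<open>auto simp: mat2_in_SL2 algebra_simps\<close>)

lemma normal_SL2_center: "SL2_center \<lhd> SL2"
proof -
  interpret group SL2 by (rule group_SL2)
  have "subgroup SL2_center SL2"
    by (rule subgroupI) (auto simp: SL2_center_eq mat2_in_SL2 SL2_simps inv_SL2 mat2_mult)
  moreover have "A \<otimes>\<^bsub>SL2\<^esub> C \<otimes>\<^bsub>SL2\<^esub> inv\<^bsub>SL2\<^esub> A \<in> SL2_center"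
    if "A \<in> carrier SL2" "C \<in> SL2_center" for A C
  proof -
    obtain a b c d where [simp]: "A = mat2 a b c d" by (rule mat2_exhaust)
    have "a * d - b * c = 1" using that by (simp add: mat2_in_SL2)
    then show ?thesis using that(2)
      by (auto simp: SL2_center_eq inv_SL2 SL2_simps mat2_mult mat2_eq_iff algebra_simps)
  qed
  ultimately show ?thesis by (simp add: normal_inv_iff)
qed

lemma PSL2_class_mat2:
  "PSL2_class (mat2 a b c d) = {mat2 a b c d, mat2 (-a) (-b) (-c) (-d)}"
  by (auto simp: PSL2_class_def r_coset_def SL2_center_eq SL2_simps mat2_mult)

lemma PSL2_class_uminus: "PSL2_class (mat2 (-a) (-b) (-c) (-d)) = PSL2_class (mat2 a b c d)"
  by (auto simp: PSL2_class_mat2)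

lemma PSL2_mult:
  assumes "A \<in> carrier SL2" "B \<in> carrier SL2"
  shows "PSL2_class A \<otimes>\<^bsub>PSL2\<^esub> PSL2_class B = PSL2_class (A ** B)"
  using normal.rcos_sum[OF normal_SL2_center assms]
  by (simp add: PSL2_def FactGroup_def PSL2_class_def SL2_simps)

lemma PSL2_inv:
  assumes "a * d - b * c = 1"
  shows "inv\<^bsub>PSL2\<^esub> (PSL2_class (mat2 a b c d)) = PSL2_class (mat2 d (-b) (-c) a)"
proof -
  have "mat2 a b c d \<in> carrier SL2" using assms by (simp add: mat2_in_SL2)
  moreover from this have "PSL2_class (mat2 a b c d) \<in> carrier (SL2 Mod SL2_center)"
    by (auto simp: PSL2_class_def FactGroup_def RCOSETS_def)
  ultimately show ?thesis
    using normal.inv_FactGroup[OF normal_SL2_center] normal.rcos_inv[OF normal_SL2_center] assms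
    by (simp add: PSL2_def PSL2_class_def inv_SL2)
qed

lemma PSL2_one: "\<one>\<^bsub>PSL2\<^esub> = PSL2_class (mat2 1 0 0 1)"
  by (simp add: PSL2_def FactGroup_def SL2_center_eq PSL2_class_mat2)

section \<open>Matrices representing elements of the group, and column operations\<close>

definition H4_matrix :: "real \<Rightarrow> real \<Rightarrow> real \<Rightarrow> real \<Rightarrow> bool" where
  "H4_matrix a b c d \<longleftrightarrow> a * d - b * c = 1 \<and> PSL2_class (mat2 a b c d) \<in> H4"

lemma H4_column_iff: "H4_column p q \<longleftrightarrow> (\<exists>r s. H4_matrix p r q s)"
  by (simp add: H4_column_def H4_matrix_def mat2_in_SL2)

lemma H4_matrix_columnD: "H4_matrix p r q s \<Longrightarrow> H4_column p q"
  by (auto simp: H4_column_iff)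

lemma H4_matrix_one: "H4_matrix 1 0 0 1"
  unfolding H4_matrix_def H4_def PSL2_one[symmetric] by (simp add: generate.one)

lemma H4_matrix_uminus: "H4_matrix a b c d \<Longrightarrow> H4_matrix (- a) (- b) (- c) (- d)"
  by (simp add: H4_matrix_def PSL2_class_uminus)

lemma H4_matrix_mult:
  assumes "H4_matrix a b c d" "H4_matrix a' b' c' d'"
  shows "H4_matrix (a * a' + b * c') (a * b' + b * d') (c * a' + d * c') (c * b' + d * d')"
proof -
  have *: "mat2 a b c d \<in> carrier SL2" "mat2 a' b' c' d' \<in> carrier SL2"
    using assms by (auto simp: H4_matrix_def mat2_in_SL2)
  have "PSL2_class (mat2 a b c d ** mat2 a' b' c' d') \<in> H4"
    using assms by (auto simp: H4_matrix_def H4_def PSL2_mult[OF *, symmetric] intro: generate.eng)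
  moreover have "mat2 a b c d ** mat2 a' b' c' d' \<in> carrier SL2"
    using * by (simp add: SL2_def det_mul)
  ultimately show ?thesis
    by (simp add: H4_matrix_def mat2_mult mat2_in_SL2)
qed

lemma H4_matrix_swap:
  assumes "H4_matrix a b c d"
  shows "H4_matrix b (- a) d (- c)"
proof -
  have "H4_matrix 0 (-1) 1 0"
    by (auto simp: H4_matrix_def H4_def intro: generate.incl)
  from H4_matrix_mult[OF assms this] show ?thesis by simp
qed

lemma H4_matrix_sqrt2: "H4_matrix 1 (of_int k * sqrt 2) 0 1"
proof -
  have pos: "H4_matrix 1 (sqrt 2) 0 1"
    by (auto simp: H4_matrix_def H4_def intro: generate.incl)
  have "inv\<^bsub>PSL2\<^esub> (PSL2_class (mat2 1 (sqrt 2) 0 1)) \<in> H4"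
    unfolding H4_def by (rule generate.inv) simp
  then have neg: "H4_matrix 1 (- sqrt 2) 0 1"
    by (simp add: H4_matrix_def PSL2_inv)
  show ?thesis
  proof (induction k rule: int_induct[where k = 0])
    case base then show ?case by (simp add: H4_matrix_one)
  next
    case (step1 i) from H4_matrix_mult[OF step1(2) pos] show ?case by (simp add: algebra_simps)
  next
    case (step2 i) from H4_matrix_mult[OF step2(2) neg] show ?case by (simp add: algebra_simps)
  qed
qed

lemma H4_matrix_translate:
  assumes "H4_matrix a b c d"
  shows "H4_matrix a (b + of_int k * sqrt 2 * a) c (d + of_int k * sqrt 2 * c)"
  using H4_matrix_mult[OF assms H4_matrix_sqrt2[of k]] by (simp add: algebra_simps)

section \<open>Integrality of matrix entries and of coordinates\<close>

text \<open>Serves both for columns of the group and for coordinates with respect to a basis of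
  columns. It records integrality only; unimodularity enters through determinants.\<close>

definition hecke_pair :: "real \<Rightarrow> real \<Rightarrow> bool" where
  "hecke_pair m n \<longleftrightarrow>
     (\<exists>a c :: int. m = of_int a \<and> n = sqrt 2 * of_int c \<or> m = sqrt 2 * of_int a \<and> n = of_int c)"

text \<open>The first shape is that of words in which the generator \<open>mat2 0 (-1) 1 0\<close>
  occurs an even number of times, the second that of an odd number.\<close>

definition hecke_type :: "real \<Rightarrow> real \<Rightarrow> real \<Rightarrow> real \<Rightarrow> bool" where
  "hecke_type a b c d \<longleftrightarrow> (\<exists>i j k l :: int.
     a = of_int i \<and> b = sqrt 2 * of_int j \<and> c = sqrt 2 * of_int k \<and> d = of_int l \<or>
     a = sqrt 2 * of_int i \<and> b = of_int j \<and> c = of_int k \<and> d = sqrt 2 * of_int l)"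

lemma hecke_type_mult:
  assumes "hecke_type a b c d" "hecke_type a' b' c' d'"
  shows "hecke_type (a * a' + b * c') (a * b' + b * d') (c * a' + d * c') (c * b' + d * d')"
proof -
  have w: "sqrt 2 * (sqrt 2 * x) = 2 * x" for x by (simp add: mult.assoc[symmetric])
  obtain i j k l :: int where 1:
    "a = of_int i \<and> b = sqrt 2 * of_int j \<and> c = sqrt 2 * of_int k \<and> d = of_int l \<or>
     a = sqrt 2 * of_int i \<and> b = of_int j \<and> c = of_int k \<and> d = sqrt 2 * of_int l"
    using assms(1) unfolding hecke_type_def by blast
  obtain i' j' k' l' :: int where 2:
    "a' = of_int i' \<and> b' = sqrt 2 * of_int j' \<and> c' = sqrt 2 * of_int k' \<and> d' = of_int l' \<or>
     a' = sqrt 2 * of_int i' \<and> b' = of_int j' \<and> c' = of_int k' \<and> d' = sqrt 2 * of_int l'"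
    using assms(2) unfolding hecke_type_def by blast
  from 1 2 show ?thesis
  proof (elim disjE, goal_cases)
    case 1 then show ?thesis unfolding hecke_type_def
      by (intro exI[of _ "i*i'+2*j*k'"] exI[of _ "i*j'+j*l'"] exI[of _ "k*i'+l*k'"] exI[of _ "2*k*j'+l*l'"])
        (simp add: algebra_simps w)
  next
    case 2 then show ?thesis unfolding hecke_type_def
      by (intro exI[of _ "i*i'+j*k'"] exI[of _ "i*j'+2*j*l'"] exI[of _ "2*k*i'+l*k'"] exI[of _ "k*j'+l*l'"])
        (simp add: algebra_simps w)
  next
    case 3 then show ?thesis unfolding hecke_type_def
      by (intro exI[of _ "i*i'+j*k'"] exI[of _ "2*i*j'+j*l'"] exI[of _ "k*i'+2*l*k'"] exI[of _ "k*j'+l*l'"])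
        (simp add: algebra_simps w)
  next
    case 4 then show ?thesis unfolding hecke_type_def
      by (intro exI[of _ "2*i*i'+j*k'"] exI[of _ "i*j'+j*l'"] exI[of _ "k*i'+l*k'"] exI[of _ "k*j'+2*l*l'"])
        (simp add: algebra_simps w)
  qed
qed

lemma hecke_type_inverse:
  assumes "hecke_type a b c d"
  shows "hecke_type d (- b) (- c) a"
proof -
  obtain i j k l :: int where
    "a = of_int i \<and> b = sqrt 2 * of_int j \<and> c = sqrt 2 * of_int k \<and> d = of_int l \<or>
     a = sqrt 2 * of_int i \<and> b = of_int j \<and> c = of_int k \<and> d = sqrt 2 * of_int l"
    using assms unfolding hecke_type_def by blast
  then show ?thesis unfolding hecke_type_def
    by (intro exI[of _ l] exI[of _ "-j"] exI[of _ "-k"] exI[of _ i]) auto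
qed

lemma hecke_type_uminus:
  assumes "hecke_type (- a) (- b) (- c) (- d)"
  shows "hecke_type a b c d"
proof -
  obtain i j k l :: int where
    "-a = of_int i \<and> -b = sqrt 2 * of_int j \<and> -c = sqrt 2 * of_int k \<and> -d = of_int l \<or>
     -a = sqrt 2 * of_int i \<and> -b = of_int j \<and> -c = of_int k \<and> -d = sqrt 2 * of_int l"
    using assms unfolding hecke_type_def by blast
  then show ?thesis unfolding hecke_type_def
    by (intro exI[of _ "-i"] exI[of _ "-j"] exI[of _ "-k"] exI[of _ "-l"]) auto
qed

lemma hecke_type_generators: "hecke_type 1 (sqrt 2) 0 1" "hecke_type 0 (-1) 1 0" "hecke_type 1 0 0 1"
proof -
  show "hecke_type 1 (sqrt 2) 0 1" unfolding hecke_type_def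
    by (intro exI[of _ 1] exI[of _ 1] exI[of _ 0] exI[of _ 1]) simp
  show "hecke_type 0 (-1) 1 0" unfolding hecke_type_def
    by (intro exI[of _ 0] exI[of _ "-1"] exI[of _ 1] exI[of _ 0]) simp
  show "hecke_type 1 0 0 1" unfolding hecke_type_def
    by (intro exI[of _ 1] exI[of _ 0] exI[of _ 0] exI[of _ 1]) simp
qed

lemma H4_class_hecke_type:
  assumes "X \<in> H4"
  shows "\<exists>a b c d. X = PSL2_class (mat2 a b c d) \<and> a * d - b * c = 1 \<and> hecke_type a b c d"
  using assms unfolding H4_def
proof (induction rule: generate.induct)
  case one
  show ?case unfolding PSL2_one
    by (intro exI[of _ 1] exI[of _ 0] exI[of _ 0] exI[of _ 1]) (simp add: hecke_type_generators)
next
  case (incl h)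
  then consider "h = PSL2_class (mat2 1 (sqrt 2) 0 1)" | "h = PSL2_class (mat2 0 (-1) 1 0)" by blast
  then show ?case
  proof cases
    case 1 then show ?thesis
      by (intro exI[of _ 1] exI[of _ "sqrt 2"] exI[of _ 0] exI[of _ 1]) (simp add: hecke_type_generators)
  next
    case 2 then show ?thesis
      by (intro exI[of _ 0] exI[of _ "-1"] exI[of _ 1] exI[of _ 0]) (simp add: hecke_type_generators)
  qed
next
  case (inv h)
  then consider "h = PSL2_class (mat2 1 (sqrt 2) 0 1)" | "h = PSL2_class (mat2 0 (-1) 1 0)" by blast
  then show ?case
  proof cases
    case 1 then show ?thesis using hecke_type_inverse[OF hecke_type_generators(1)]
      by (intro exI[of _ 1] exI[of _ "- sqrt 2"] exI[of _ 0] exI[of _ 1]) (simp add: PSL2_inv)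
  next
    case 2 then show ?thesis using hecke_type_inverse[OF hecke_type_generators(2)]
      by (intro exI[of _ 0] exI[of _ "1"] exI[of _ "-1"] exI[of _ 0]) (simp add: PSL2_inv)
  qed
next
  case (eng X Y)
  then obtain a b c d a' b' c' d' where
    X: "X = PSL2_class (mat2 a b c d)" "a * d - b * c = 1" "hecke_type a b c d" and
    Y: "Y = PSL2_class (mat2 a' b' c' d')" "a' * d' - b' * c' = 1" "hecke_type a' b' c' d'"
    by blast
  have in_SL2: "mat2 a b c d \<in> carrier SL2" "mat2 a' b' c' d' \<in> carrier SL2"
    using X Y by (simp_all add: mat2_in_SL2)
  then have "mat2 a b c d ** mat2 a' b' c' d' \<in> carrier SL2" by (simp add: SL2_def det_mul)
  then show ?case
    using PSL2_mult[OF in_SL2] hecke_type_mult[OF X(3) Y(3)] X(1) Y(1)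
    unfolding mat2_mult mat2_in_SL2 by metis
qed

lemma H4_matrix_hecke_type:
  assumes "H4_matrix a b c d"
  shows "hecke_type a b c d"
proof -
  obtain a' b' c' d' where *: "PSL2_class (mat2 a b c d) = PSL2_class (mat2 a' b' c' d')"
    "hecke_type a' b' c' d'"
    using assms H4_class_hecke_type unfolding H4_matrix_def by blast
  have "mat2 a b c d \<in> PSL2_class (mat2 a' b' c' d')"
    unfolding *(1)[symmetric] by (simp add: PSL2_class_mat2)
  then show ?thesis using * hecke_type_uminus by (auto simp: PSL2_class_mat2 mat2_eq_iff)
qed

lemma hecke_type_columnD:
  assumes "hecke_type a b c d"
  shows "hecke_pair a c"
  using assms unfolding hecke_type_def hecke_pair_def by blast

text \<open>With a zero corner the determinant is \<open>- b * c\<close>. Two factors in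
  \<open>sqrt 2\<close> times the integers would make it even, so they are integers and units. Later
  this says that a column proportional to a convergent is that convergent up to sign.\<close>

lemma hecke_type_first_zero:
  assumes "hecke_type 0 b c d" "0 * d - b * c = 1"
  shows "\<bar>c\<bar> = 1"
proof -
  obtain i j k l :: int where
    "b = sqrt 2 * of_int j \<and> c = sqrt 2 * of_int k \<or> b = of_int j \<and> c = of_int k"
    using assms unfolding hecke_type_def by blast
  then show ?thesis
  proof
    assume "b = sqrt 2 * of_int j \<and> c = sqrt 2 * of_int k"
    then have "(sqrt 2 * sqrt 2) * of_int (- (j * k)) = (1::real)" using assms(2) by (simp add: algebra_simps)
    then have "of_int (- 2 * (j * k)) = (1::real)" by simp
    then have "- 2 * (j * k) = 1" by linarith
    moreover have "- 2 * i \<noteq> 1" for i :: int by presburger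
    ultimately show ?thesis by blast
  next
    assume bc: "b = of_int j \<and> c = of_int k"
    then have "of_int (- j * k) = (1::real)" using assms(2) by simp
    then have "- j * k = 1" by linarith
    then have "\<bar>k\<bar> = 1" by (metis dvd_triv_right zdvd1_eq)
    then show ?thesis using bc by linarith
  qed
qed

text \<open>The coordinates are, up to sign, the first column of an inverse basis matrix times a
  matrix with first column \<open>p\<close>, \<open>q\<close>, so they inherit the integrality of
  the group.\<close>

lemma H4_coordinates:
  assumes "H4_matrix P R Q S" "H4_column p q"
  obtains m n where "p = m * R + n * P" "q = m * S + n * Q" "hecke_pair m n" "m = 0 \<Longrightarrow> \<bar>n\<bar> = 1"
    "m = P * q - Q * p"
proof -
  obtain r s where M: "H4_matrix p r q s" using assms(2) by (auto simp: H4_column_iff)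
  have det: "P * S - R * Q = 1" "p * s - r * q = 1"
    using assms(1) M by (auto simp: H4_matrix_def)
  have swapped: "hecke_type R (- P) S (- Q)"
    by (intro H4_matrix_hecke_type H4_matrix_swap assms)
  have "hecke_type (- Q * p + P * q) (- Q * r + P * s) (- S * p + R * q) (- S * r + R * s)"
    using hecke_type_mult[OF hecke_type_inverse[OF swapped] H4_matrix_hecke_type[OF M]] by simp
  moreover have "(- Q * p + P * q) * (- S * r + R * s) - (- Q * r + P * s) * (- S * p + R * q) =
      (P * S - R * Q) * (p * s - r * q)" by algebra
  ultimately have t: "hecke_type (P * q - Q * p) (- Q * r + P * s) (- (S * p - R * q)) (- S * r + R * s)"
    and d: "(P * q - Q * p) * (- S * r + R * s) - (- Q * r + P * s) * (- (S * p - R * q)) = 1"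
    unfolding det by (simp_all add: algebra_simps)
  have pair: "hecke_pair (P * q - Q * p) (S * p - R * q)"
    using hecke_type_columnD[OF t] unfolding hecke_pair_def
    by (metis (no_types, opaque_lifting) add.inverse_inverse mult_minus_right of_int_minus)
  show ?thesis
  proof
    have "(P * q - Q * p) * R + (S * p - R * q) * P = (P * S - R * Q) * p" by algebra
    then show "p = (P * q - Q * p) * R + (S * p - R * q) * P" using det by simp
    have "(P * q - Q * p) * S + (S * p - R * q) * Q = (P * S - R * Q) * q" by algebra
    then show "q = (P * q - Q * p) * S + (S * p - R * q) * Q" using det by simp
    show "P * q - Q * p = 0 \<Longrightarrow> \<bar>S * p - R * q\<bar> = 1"
      using hecke_type_first_zero[of "- Q * r + P * s" "- (S * p - R * q)" "- S * r + R * s"] t d by simp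
  qed (use pair in auto)
qed

section \<open>Coefficient inequalities\<close>

lemma sqrt2_bounds: "7 / 5 < sqrt (2::real)" "sqrt (2::real) < 10 / 7"
  using real_less_rsqrt[of "7 / 5" 2] real_less_lsqrt[of "10 / 7" 2] by (simp_all add: power2_eq_square)

lemma less_sqrt2_minus_1_mult:
  fixes S T :: real
  assumes "(sqrt 2 + 1) * S < T"
  shows "S < (sqrt 2 - 1) * T"
proof -
  have "(sqrt 2 - 1) * ((sqrt 2 + 1) * S) < (sqrt 2 - 1) * T"
    using assms sqrt2_bounds by (intro mult_strict_left_mono) auto
  moreover have "(sqrt 2 - 1) * ((sqrt 2 + 1) * S) = S" by (simp add: algebra_simps)
  ultimately show ?thesis by (simp only:)
qed

lemma sign_mult_gt:
  fixes e S T :: real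
  assumes "e = 1 \<or> e = -1" "0 \<le> S" "0 < T" "e = -1 \<Longrightarrow> (sqrt 2 + 1) * S < T"
  shows "e * S > - (sqrt 2 - 1) * T"
  using assms(1)
proof
  assume "e = 1"
  then have "e * S = S" by simp
  moreover have "(sqrt 2 - 1) * T > 0" using assms sqrt2_bounds by simp
  ultimately show ?thesis using assms by linarith
next
  assume "e = -1"
  then have "e * S = - S" by simp
  moreover have "S < (sqrt 2 - 1) * T" using less_sqrt2_minus_1_mult assms \<open>e = -1\<close> by blast
  ultimately show ?thesis by linarith
qed

lemma hecke_pair_commute: "hecke_pair m n \<longleftrightarrow> hecke_pair n m"
  unfolding hecke_pair_def by blast

lemma hecke_pair_abs:
  assumes "hecke_pair m n"
  shows "hecke_pair \<bar>m\<bar> \<bar>n\<bar>"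
proof -
  obtain a c :: int where "m = of_int a \<and> n = sqrt 2 * of_int c \<or> m = sqrt 2 * of_int a \<and> n = of_int c"
    using assms unfolding hecke_pair_def by blast
  then show ?thesis unfolding hecke_pair_def
    by (intro exI[of _ "\<bar>a\<bar>"] exI[of _ "\<bar>c\<bar>"]) (auto simp: abs_mult)
qed

text \<open>The positive values are 1, \<open>sqrt 2\<close> and numbers at least 2, and an integer
  is always paired with a multiple of \<open>sqrt 2\<close>, which rules out \<open>(1, 1)\<close>
  and \<open>(sqrt 2, sqrt 2)\<close>. The two smallest pairs that remain are the sources of the
  exceptional columns.\<close>

lemma hecke_pair_pos_cases:
  assumes "hecke_pair m n" "m > 0" "n > 0"
  obtains "m = 1" "n = sqrt 2" | "m = 1" "n > 2" | "m = sqrt 2" "n = 1" | "m = sqrt 2" "n \<ge> 2"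
    | "m \<ge> 2" "n = 1" | "m \<ge> 2" "n = sqrt 2" | "m \<ge> 2" "n \<ge> 2"
proof -
  note w = sqrt2_bounds
  have mult: "sqrt 2 * of_int k > 2" if "k \<ge> 2" for k :: int
  proof -
    have "sqrt 2 * of_int k \<ge> sqrt 2 * 2" using that by (intro mult_left_mono) auto
    then show ?thesis using w by linarith
  qed
  have pos: "k = 1 \<or> k \<ge> 2" if "0 < k" for k :: int using that by presburger
  obtain a c :: int where "m = of_int a \<and> n = sqrt 2 * of_int c \<or> m = sqrt 2 * of_int a \<and> n = of_int c"
    using assms unfolding hecke_pair_def by blast
  then show ?thesis
  proof
    assume *: "m = of_int a \<and> n = sqrt 2 * of_int c"
    then have "a > 0" "c > 0" using assms by (simp_all add: zero_less_mult_iff)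
    then show ?thesis using pos[of a] pos[of c] * mult[of c] that(1,2,6,7) by fastforce
  next
    assume *: "m = sqrt 2 * of_int a \<and> n = of_int c"
    then have "a > 0" "c > 0" using assms by (simp_all add: zero_less_mult_iff)
    then show ?thesis using pos[of a] pos[of c] * mult[of a] that(3,4,5,7) by fastforce
  qed
qed

lemma hecke_pair_abs_ge_1:
  assumes "hecke_pair m n" "m \<noteq> 0"
  shows "\<bar>m\<bar> \<ge> 1"
proof -
  note w = sqrt2_bounds
  have *: "1 \<le> \<bar>k\<bar>" if "k \<noteq> 0" for k :: int using that by presburger
  obtain a c :: int where "m = of_int a \<or> m = sqrt 2 * of_int a"
    using assms unfolding hecke_pair_def by blast
  then show ?thesis
  proof
    assume "m = of_int a"
    then show ?thesis using *[of a] assms by simp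
  next
    assume m: "m = sqrt 2 * of_int a"
    then have "1 \<le> \<bar>real_of_int a\<bar>" using *[of a] assms by simp
    then have "sqrt 2 * 1 \<le> sqrt 2 * \<bar>real_of_int a\<bar>" by (intro mult_left_mono) auto
    then show ?thesis using w unfolding m abs_mult by (simp only: abs_of_pos real_sqrt_gt_0_iff)
  qed
qed

lemma mult_ge_self:
  fixes a b :: real
  assumes "1 \<le> a" "0 \<le> b"
  shows "b \<le> a * b"
  using mult_right_mono[OF assms] by simp

text \<open>
  In what follows \<open>(S, T)\<close> are the denominators of two consecutive convergents, \<open>(m, n)\<close> are
  the coordinates of another column of the group with respect to them, and \<open>x\<close> and \<open>e\<close> are the next
  complete quotient and its sign; the error of the column is \<open>\<bar>m * x - e * n\<bar>\<close> times the error of the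
  second convergent.
\<close>

lemma opposite_signs:
  fixes m n S T x e :: real
  assumes "hecke_pair m n" "m \<noteq> 0" "n \<noteq> 0" "0 \<le> S" "0 < T" "0 < m * S + n * T" "1 < x"
    and e: "e = 1 \<or> e = -1"
  obtains "n \<ge> 1" "m \<ge> 1" | "e = 1" "\<bar>m * x - e * n\<bar> > x"
    | "e = -1" "\<bar>n\<bar> * T - \<bar>m\<bar> * S = m * S + n * T \<or> \<bar>n\<bar> * T - \<bar>m\<bar> * S = - (m * S + n * T)"
      "\<bar>\<bar>m\<bar> * x - \<bar>n\<bar>\<bar> = \<bar>m * x - e * n\<bar>" "m < 0 \<and> n > 0 \<or> m > 0 \<and> n < 0"
proof -
  have m: "\<bar>m\<bar> \<ge> 1" and n: "\<bar>n\<bar> \<ge> 1"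
    using hecke_pair_abs_ge_1 assms hecke_pair_commute by blast+
  consider "m > 0" "n > 0" | "m < 0" "n < 0" | "m > 0" "n < 0" | "m < 0" "n > 0"
    using assms by linarith
  then show ?thesis
  proof cases
    case 1 then show ?thesis using m n that(1) by linarith
  next
    case 2
    then have "m * S \<le> 0" "n * T < 0" using assms by (simp_all add: mult_nonpos_nonneg mult_neg_pos)
    then show ?thesis using assms by linarith
  next
    case 3
    have "x \<le> m * x" using m 3 assms by (intro mult_ge_self) auto
    from e show ?thesis
    proof
      assume "e = 1"
      moreover have "m * x - n > x" using \<open>x \<le> m * x\<close> 3 by linarith
      ultimately show ?thesis using that(2) by simp
    next
      assume "e = -1"
      then show ?thesis using 3 by (intro that(3)) auto
    qed
  next
    case 4
    have "x \<le> -m * x" using m 4 assms by (intro mult_ge_self) auto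
    from e show ?thesis
    proof
      assume "e = 1"
      moreover have "- m * x + n > x" using \<open>x \<le> -m * x\<close> 4 by linarith
      ultimately show ?thesis using that(2) by simp
    next
      assume "e = -1"
      then show ?thesis using 4 by (intro that(3)) (auto simp: abs_if)
    qed
  qed
qed

text \<open>The critical case is \<open>e = -1\<close> with opposite signs: the denominator bound
  gives \<open>\<nu> < 1 + \<mu> * sqrt 2 - \<mu>\<close>, so the error
  \<open>\<mu> * x - \<nu>\<close> exceeds \<open>\<mu> - 1\<close>. This suffices for
  \<open>\<mu> \<ge> 2\<close>, and the pair \<open>(sqrt 2, 1)\<close> gives more than
  \<open>2 - 1\<close>.\<close>

lemma rosen_error_gt:
  fixes m n S T x e :: real
  assumes L: "hecke_pair m n" and m0: "m \<noteq> 0" and S: "0 \<le> S" "S < T" and x: "sqrt 2 < x"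
    and e: "e = 1 \<or> e = -1" and eS: "e = -1 \<Longrightarrow> (sqrt 2 + 1) * S < T"
    and q: "0 < m * S + n * T" "m * S + n * T \<le> T"
  shows "\<bar>m * x - e * n\<bar> > 1"
proof (cases "n = 0")
  case True
  have "\<bar>m\<bar> \<ge> 1" using hecke_pair_abs_ge_1 L m0 by blast
  then have "x \<le> \<bar>m\<bar> * x" using x by (intro mult_ge_self) (use sqrt2_bounds in linarith)+
  then have "1 < \<bar>m\<bar> * x" using x sqrt2_bounds by linarith
  then show ?thesis using True x sqrt2_bounds by (simp add: abs_mult)
next
  case n0: False
  note w = sqrt2_bounds
  have x1: "1 < x" using x w by linarith
  have T: "0 < T" using S by linarith
  from L m0 n0 S(1) T q(1) x1 e show ?thesis
  proof (cases rule: opposite_signs)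
    case 1
    then have "T \<le> n * T" using T by (intro mult_ge_self) auto
    moreover have "S \<le> m * S" using 1 S by (intro mult_ge_self) auto
    \<comment> \<open>Equal signs make the denominators add up, so this is the initial column with
      denominator 0. The partner of \<open>n = 1\<close> is a multiple of \<open>sqrt 2\<close>, and
      the error exceeds \<open>2 - 1\<close>.\<close>
    ultimately have "S = 0" "n * T \<le> T" using q S by linarith+
    then have n: "n = 1" using 1 T by simp
    have "0 < m" "0 < n" using 1 by auto
    with L have "m \<ge> sqrt 2"
      using n w by (cases m n rule: hecke_pair_pos_cases) auto
    then have "sqrt 2 * x \<le> m * x" using x1 by (intro mult_right_mono) auto
    moreover have "sqrt 2 * sqrt 2 < sqrt 2 * x" using x by (intro mult_strict_left_mono) auto
    ultimately show ?thesis using e n by auto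
  next
    case 2 then show ?thesis using x1 by linarith
  next
    case 3
    define \<mu> \<nu> where "\<mu> = \<bar>m\<bar>" "\<nu> = \<bar>n\<bar>"
    have pos: "\<mu> > 0" "\<nu> > 0" and L': "hecke_pair \<mu> \<nu>"
      using m0 n0 hecke_pair_abs[OF L] by (auto simp: \<mu>_\<nu>_def)
    have "\<nu> * T - \<mu> * S \<le> T" using 3 q by (auto simp: \<mu>_\<nu>_def)
    moreover have "S < (sqrt 2 - 1) * T" using less_sqrt2_minus_1_mult eS 3 by blast
    then have "\<mu> * S < \<mu> * ((sqrt 2 - 1) * T)" using pos by (intro mult_strict_left_mono)
    ultimately have "(\<nu> - 1) * T < (\<mu> * (sqrt 2 - 1)) * T" by (simp add: algebra_simps)
    then have \<nu>: "\<nu> - 1 < \<mu> * (sqrt 2 - 1)" using T by simp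
    have \<mu>x: "\<mu> * sqrt 2 < \<mu> * x" using pos x by (intro mult_strict_left_mono)
    from \<nu> have \<nu>': "\<nu> < 1 + \<mu> * sqrt 2 - \<mu>" by (simp add: algebra_simps)
    have ww: "sqrt 2 * sqrt 2 = (2::real)" by simp
    have "\<mu> * x - \<nu> > 1"
      using L' pos
    proof (cases \<mu> \<nu> rule: hecke_pair_pos_cases)
      case 3
      then show ?thesis using \<mu>x ww w by simp
    next
      case 5 then show ?thesis using \<mu>x \<nu>' by linarith
    next
      case 6 then show ?thesis using \<mu>x \<nu>' by linarith
    next
      case 7 then show ?thesis using \<mu>x \<nu>' by linarith
    qed (use \<nu> w ww in \<open>simp_all add: algebra_simps\<close>)
    then show ?thesis using 3 by (auto simp: \<mu>_\<nu>_def)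
  qed
qed

text \<open>Common start of the analysis of both expansions. The denominator condition yields the
  bound on \<open>\<nu>\<close>, the error condition the one on \<open>\<mu>\<close>; with equal
  signs the denominators would add up past \<open>T\<close>, and with \<open>e = 1\<close> the
  errors past \<open>x\<close>.\<close>

lemma small_error_opposite_signs:
  fixes m n S T x e :: real
  assumes L: "hecke_pair m n" and S: "0 < S" "S < T" and x: "1 < x" and e: "e = 1 \<or> e = -1"
    and q: "0 < m * S + n * T" "m * S + n * T < T" and err: "\<bar>m * x - e * n\<bar> < x"
  obtains \<mu> \<nu> where "e = -1" "hecke_pair \<mu> \<nu>" "1 \<le> \<mu>" "0 < \<nu>" "(\<nu> - 1) * T < \<mu> * S" "(\<mu> - 1) * x < \<nu>"
    "m = \<mu> \<and> n = - \<nu> \<or> m = - \<mu> \<and> n = \<nu>"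
proof -
  have m0: "m \<noteq> 0"
  proof
    assume m: "m = 0"
    then have "n > 0" using q S by (simp add: zero_less_mult_iff)
    then have "n \<ge> 1" using hecke_pair_abs_ge_1[of n m] L hecke_pair_commute by fastforce
    then have "n * T \<ge> T" using S by (intro mult_ge_self) auto
    moreover have "m * S = 0" using m by simp
    ultimately show False using q by linarith
  qed
  then have m1: "\<bar>m\<bar> \<ge> 1" using hecke_pair_abs_ge_1 L by blast
  then have mx: "\<bar>m\<bar> * x \<ge> x" using x by (intro mult_ge_self) auto
  have n0: "n \<noteq> 0" using mx err x by (auto simp: abs_mult)
  have S': "0 \<le> S" "0 < T" using S by auto
  from L m0 n0 S' q(1) x e show ?thesis
  proof (cases rule: opposite_signs)
    case 1
    then have "T \<le> n * T" "0 < m * S" using S by (auto intro: mult_ge_self)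
    then show ?thesis using q by linarith
  next
    case 2 then show ?thesis using err by linarith
  next
    case 3
    show ?thesis
    proof (rule that[of "\<bar>m\<bar>" "\<bar>n\<bar>"])
      show "(\<bar>n\<bar> - 1) * T < \<bar>m\<bar> * S" using 3 q by (auto simp: algebra_simps)
      show "(\<bar>m\<bar> - 1) * x < \<bar>n\<bar>" using 3 err by (auto simp: algebra_simps)
    qed (use 3 n0 m1 hecke_pair_abs[OF L] in auto)
  qed
qed

text \<open>Replacing \<open>x\<close> by \<open>sqrt 2\<close> and \<open>S\<close> by
  \<open>(sqrt 2 - 1) * T\<close> leaves \<open>(\<mu> - 1) * sqrt 2 < \<nu>\<close> and
  \<open>\<nu> - 1 < \<mu> * (sqrt 2 - 1)\<close>. For \<open>\<mu> \<noteq> 1\<close> they give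
  \<open>\<mu> < sqrt 2 + 1\<close> and then \<open>\<nu> < 2\<close>; running through the small
  pairs leaves only \<open>(sqrt 2, 1)\<close>.\<close>

lemma rosen_intermediate:
  fixes m n S T x e :: real
  assumes L: "hecke_pair m n" and S: "0 < S" "S < T" and x: "sqrt 2 < x" and e: "e = 1 \<or> e = -1"
    and eS: "e = -1 \<Longrightarrow> (sqrt 2 + 1) * S < T"
    and q: "0 < m * S + n * T" "m * S + n * T < T" and err: "\<bar>m * x - e * n\<bar> < x"
  shows "e = -1 \<and> x < sqrt 2 + 1 \<and> m = - sqrt 2 \<and> n = 1"
proof -
  note w = sqrt2_bounds
  have x1: "1 < x" using x w by linarith
  from L S x1 e q err obtain \<mu> \<nu> where e': "e = -1" and L': "hecke_pair \<mu> \<nu>" and pos: "1 \<le> \<mu>" "0 < \<nu>"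
    and \<nu>: "(\<nu> - 1) * T < \<mu> * S" and \<mu>: "(\<mu> - 1) * x < \<nu>"
    and mn: "m = \<mu> \<and> n = - \<nu> \<or> m = - \<mu> \<and> n = \<nu>"
    by (rule small_error_opposite_signs)
  have pos': "0 < \<mu>" using pos by simp
  have "S < (sqrt 2 - 1) * T" using less_sqrt2_minus_1_mult eS e' by blast
  then have "\<mu> * S < \<mu> * ((sqrt 2 - 1) * T)" using pos by (intro mult_strict_left_mono) auto
  then have "(\<nu> - 1) * T < (\<mu> * (sqrt 2 - 1)) * T" using \<nu> by (simp add: algebra_simps)
  then have \<nu>': "\<nu> - 1 < \<mu> * (sqrt 2 - 1)" using S by simp
  have \<mu>': "(\<mu> - 1) * sqrt 2 < \<nu> \<or> \<mu> = 1" 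
  proof (cases "\<mu> = 1")
    case False
    then have "(\<mu> - 1) * sqrt 2 < (\<mu> - 1) * x" using pos x by (intro mult_strict_left_mono) auto
    then show ?thesis using \<mu> by simp
  qed simp
  have ww: "sqrt 2 * sqrt 2 = (2::real)" by simp
  have mn': "\<mu> = sqrt 2 \<and> \<nu> = 1"
    using L' pos' pos(2)
  proof (cases \<mu> \<nu> rule: hecke_pair_pos_cases)
    case 7
    then have "\<mu> * sqrt 2 - sqrt 2 < 1 + \<mu> * sqrt 2 - \<mu>" using \<nu>' \<mu>' w by (simp add: algebra_simps)
    then have "\<mu> < sqrt 2 + 1" by simp
    then have "\<mu> * (sqrt 2 - 1) < (sqrt 2 + 1) * (sqrt 2 - 1)" using w by (intro mult_strict_right_mono) auto
    then show ?thesis using 7 \<nu>' ww by (simp add: algebra_simps)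
  next
    case 5
    have "sqrt 2 * 1 \<le> (\<mu> - 1) * sqrt 2" using 5 w by simp
    then show ?thesis using \<mu>' 5 w by linarith
  next
    case 6
    have "sqrt 2 * 1 \<le> (\<mu> - 1) * sqrt 2" using 6 w by simp
    then show ?thesis using \<mu>' 6 w by linarith
  qed (use \<nu>' w ww pos in \<open>simp_all add: algebra_simps\<close>)
  then have "(sqrt 2 + 1) * ((sqrt 2 - 1) * x) < (sqrt 2 + 1) * 1"
    using \<mu> w by (intro mult_strict_left_mono) auto
  moreover have "(sqrt 2 + 1) * ((sqrt 2 - 1) * x) = x" by (simp add: algebra_simps)
  ultimately have "x < sqrt 2 + 1" by simp
  moreover have "\<not> (m = \<mu> \<and> n = - \<nu>)"
  proof
    assume "m = \<mu> \<and> n = - \<nu>"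
    then have "sqrt 2 * S > T" using q mn' by simp
    moreover have "sqrt 2 * S < (sqrt 2 + 1) * S" using S by simp
    ultimately show False using eS e' by simp
  qed
  ultimately show ?thesis using mn mn' e' by auto
qed

text \<open>At \<open>x = sqrt 2 + 1\<close> the pair \<open>(1, sqrt 2)\<close> has relative error
  exactly 1; \<open>tie\<close> then pushes its denominator \<open>sqrt 2 * T - S\<close> above
  \<open>T\<close>. Positivity of \<open>S\<close> restricts the statement to convergents of index
  at least 1.\<close>

lemma dual_error_gt:
  fixes m n S T x e :: real
  assumes L: "hecke_pair m n" and m0: "m \<noteq> 0" and S: "0 < S" "sqrt 2 * S \<le> T" and x: "1 < x"
    and e: "e = 1 \<or> e = -1" and ex: "e = -1 \<Longrightarrow> sqrt 2 + 1 \<le> x"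
    and tie: "e = -1 \<Longrightarrow> x = sqrt 2 + 1 \<Longrightarrow> (sqrt 2 + 1) * S < T"
    and q: "0 < m * S + n * T" "m * S + n * T \<le> T"
  shows "\<bar>m * x - e * n\<bar> > 1"
proof (cases "n = 0")
  case True
  have "\<bar>m\<bar> \<ge> 1" using hecke_pair_abs_ge_1 L m0 by blast
  then have "x \<le> \<bar>m\<bar> * x" using x by (intro mult_ge_self) auto
  then have "1 < \<bar>m\<bar> * x" using x by linarith
  then show ?thesis using True x by (simp add: abs_mult)
next
  case n0: False
  note w = sqrt2_bounds
  have ww: "sqrt 2 * sqrt 2 = (2::real)" by simp
  have "0 < sqrt 2 * S" using S by simp
  then have T: "0 < T" using S by linarith
  from L m0 n0 less_imp_le[OF S(1)] T q(1) x e show ?thesis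
  proof (cases rule: opposite_signs)
    case 1
    then have "T \<le> n * T" "0 < m * S" using T S by (auto intro: mult_ge_self)
    then show ?thesis using q by linarith
  next
    case 2 then show ?thesis using x by linarith
  next
    case 3
    define \<mu> \<nu> where "\<mu> = \<bar>m\<bar>" "\<nu> = \<bar>n\<bar>"
    have pos: "\<mu> > 0" "\<nu> > 0" and L': "hecke_pair \<mu> \<nu>"
      using m0 n0 hecke_pair_abs[OF L] by (auto simp: \<mu>_\<nu>_def)
    have \<nu>: "(\<nu> - 1) * T \<le> \<mu> * S" using 3 q by (auto simp: \<mu>_\<nu>_def algebra_simps)
    have "\<mu> * (sqrt 2 * S) \<le> \<mu> * T" using S pos by (intro mult_left_mono) auto
    moreover have "((\<nu> - 1) * T) * sqrt 2 \<le> (\<mu> * S) * sqrt 2" using \<nu> by (intro mult_right_mono) auto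
    ultimately have "((\<nu> - 1) * sqrt 2) * T \<le> \<mu> * T" by (simp add: algebra_simps)
    then have \<nu>': "(\<nu> - 1) * sqrt 2 \<le> \<mu>" using T by simp
    then have "((\<nu> - 1) * sqrt 2) * sqrt 2 \<le> \<mu> * sqrt 2" by (intro mult_right_mono) auto
    then have \<nu>'': "2 * \<nu> \<le> 2 + \<mu> * sqrt 2" by (simp add: algebra_simps)
    have \<mu>x: "\<mu> * sqrt 2 + \<mu> \<le> \<mu> * x" using pos ex 3 mult_left_mono[of "sqrt 2 + 1" x \<mu>]
      by (simp add: algebra_simps)
    have big: ?thesis if "sqrt 2 \<le> \<mu>"
    proof -
      have "\<mu> * sqrt 2 \<ge> sqrt 2 * sqrt 2" using that by (intro mult_right_mono) auto
      then have "\<mu> * x - \<nu> > 1" using \<mu>x \<nu>'' that w ww by linarith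
      then show ?thesis using 3 by (auto simp: \<mu>_\<nu>_def)
    qed
    from L' pos show ?thesis
    proof (cases \<mu> \<nu> rule: hecke_pair_pos_cases)
      case one: 1
      have "x \<noteq> sqrt 2 + 1"
      proof
        assume "x = sqrt 2 + 1"
        then have "S < (sqrt 2 - 1) * T" using less_sqrt2_minus_1_mult tie 3 by simp
        then show False using \<nu> one by simp
      qed
      then have "\<mu> * x - \<nu> > 1" using ex 3 one by simp
      then show ?thesis using 3 by (auto simp: \<mu>_\<nu>_def)
    next
      case 2
      then show ?thesis using \<nu>'' w by simp
    qed (use big w in auto)
  qed
qed

text \<open>Here \<open>S\<close> is bounded by \<open>T / sqrt 2\<close> and \<open>x\<close> from
  below by \<open>sqrt 2 + 1\<close>. Eliminating \<open>\<nu>\<close> gives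
  \<open>\<mu> < 2\<close>, and of the pairs with \<open>\<mu>\<close> equal to 1 or
  \<open>sqrt 2\<close> only \<open>(1, sqrt 2)\<close> meets both bounds.\<close>

lemma dual_intermediate:
  fixes m n S T x e :: real
  assumes L: "hecke_pair m n" and S: "0 < S" "sqrt 2 * S \<le> T" and x: "1 < x" and e: "e = 1 \<or> e = -1"
    and ex: "e = -1 \<Longrightarrow> sqrt 2 + 1 \<le> x"
    and q: "0 < m * S + n * T" "m * S + n * T < T" and err: "\<bar>m * x - e * n\<bar> < x"
  shows "e = -1 \<and> T < (sqrt 2 + 1) * S \<and> m = -1 \<and> n = sqrt 2"
proof -
  note w = sqrt2_bounds
  have ww: "sqrt 2 * sqrt 2 = (2::real)" by simp
  have "1 * S < sqrt 2 * S" using S w by (intro mult_strict_right_mono) auto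
  then have ST: "S < T" using S by linarith
  from L S(1) ST x e q err obtain \<mu> \<nu> where e': "e = -1" and L': "hecke_pair \<mu> \<nu>" and pos: "1 \<le> \<mu>" "0 < \<nu>"
    and \<nu>: "(\<nu> - 1) * T < \<mu> * S" and \<mu>: "(\<mu> - 1) * x < \<nu>"
    and mn: "m = \<mu> \<and> n = - \<nu> \<or> m = - \<mu> \<and> n = \<nu>"
    by (rule small_error_opposite_signs)
  have pos': "0 < \<mu>" using pos by simp
  have "\<mu> * (sqrt 2 * S) \<le> \<mu> * T" using S pos by (intro mult_left_mono) auto
  moreover have "((\<nu> - 1) * T) * sqrt 2 < (\<mu> * S) * sqrt 2" using \<nu> by (intro mult_strict_right_mono) auto
  ultimately have "((\<nu> - 1) * sqrt 2) * T < \<mu> * T" by (simp add: algebra_simps)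
  then have "(\<nu> - 1) * sqrt 2 < \<mu>" using S ST by simp
  then have "((\<nu> - 1) * sqrt 2) * sqrt 2 < \<mu> * sqrt 2" by (intro mult_strict_right_mono) auto
  then have \<nu>': "2 * \<nu> < 2 + \<mu> * sqrt 2" by (simp add: algebra_simps)
  have "(\<mu> - 1) * (sqrt 2 + 1) \<le> (\<mu> - 1) * x" using pos ex e' by (intro mult_left_mono) auto
  then have \<mu>': "\<mu> * sqrt 2 + \<mu> - sqrt 2 - 1 < \<nu>" using \<mu> by (simp add: algebra_simps)
  have big: "\<mu> < 2"
  proof (rule ccontr)
    assume "\<not> \<mu> < 2"
    then have "\<mu> * sqrt 2 \<ge> 2 * sqrt 2" by (intro mult_right_mono) auto
    then show False using \<mu>' \<nu>' \<open>\<not> \<mu> < 2\<close> w by linarith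
  qed
  have mn': "\<mu> = 1 \<and> \<nu> = sqrt 2"
    using L' pos' pos(2)
    by (cases \<mu> \<nu> rule: hecke_pair_pos_cases) (use \<mu>' \<nu>' big w ww pos in \<open>simp_all add: algebra_simps\<close>)
  then have "(sqrt 2 + 1) * ((sqrt 2 - 1) * T) < (sqrt 2 + 1) * S"
    using \<nu> w by (intro mult_strict_left_mono) auto
  moreover have "(sqrt 2 + 1) * ((sqrt 2 - 1) * T) = T" by (simp add: algebra_simps)
  ultimately have "T < (sqrt 2 + 1) * S" by simp
  moreover have "\<not> (m = \<mu> \<and> n = - \<nu>)"
  proof
    assume "m = \<mu> \<and> n = - \<nu>"
    then have "S > sqrt 2 * T" using q mn' by simp
    moreover have "sqrt 2 * T > 1 * T" using S ST w by (intro mult_strict_right_mono) auto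
    ultimately show False using ST by simp
  qed
  ultimately show ?thesis using mn mn' e' by auto
qed

section \<open>Expansions and their convergents\<close>

text \<open>Indices are shifted: the \<open>n\<close>-th convergent is \<open>cf_num a \<epsilon> (Suc n) / cf_den a \<epsilon> (Suc n)\<close>.\<close>
fun cf_num :: "(nat \<Rightarrow> int) \<Rightarrow> (nat \<Rightarrow> real) \<Rightarrow> nat \<Rightarrow> real" where
  "cf_num a \<epsilon> 0 = 1"
| "cf_num a \<epsilon> (Suc 0) = of_int (a 0) * sqrt 2"
| "cf_num a \<epsilon> (Suc (Suc n)) = of_int (a (Suc n)) * sqrt 2 * cf_num a \<epsilon> (Suc n) + \<epsilon> (Suc n) * cf_num a \<epsilon> n"

fun cf_den :: "(nat \<Rightarrow> int) \<Rightarrow> (nat \<Rightarrow> real) \<Rightarrow> nat \<Rightarrow> real" where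
  "cf_den a \<epsilon> 0 = 0"
| "cf_den a \<epsilon> (Suc 0) = 1"
| "cf_den a \<epsilon> (Suc (Suc n)) = of_int (a (Suc n)) * sqrt 2 * cf_den a \<epsilon> (Suc n) + \<epsilon> (Suc n) * cf_den a \<epsilon> n"

text \<open>The recurrences extend a fraction at its last digit, while \<open>cfrac\<close> unfolds
  at the first; these identities regroup the same product of matrices.\<close>

lemma cf_shift:
  "cf_num a \<epsilon> (Suc n) = of_int (a 0) * sqrt 2 * cf_num (\<lambda>i. a (Suc i)) (\<lambda>i. \<epsilon> (Suc i)) n
     + \<epsilon> 1 * cf_den (\<lambda>i. a (Suc i)) (\<lambda>i. \<epsilon> (Suc i)) n"
  "cf_den a \<epsilon> (Suc n) = cf_num (\<lambda>i. a (Suc i)) (\<lambda>i. \<epsilon> (Suc i)) n"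
  by (induction a \<epsilon> n rule: cf_num.induct) (auto simp: algebra_simps)

lemma cfrac_eq_cf:
  assumes "\<And>k n. cf_den (\<lambda>i. a (i + k)) (\<lambda>i. \<epsilon> (i + k)) (Suc n) \<noteq> 0"
  shows "cfrac a \<epsilon> n = cf_num a \<epsilon> (Suc n) / cf_den a \<epsilon> (Suc n)"
  using assms
proof (induction n arbitrary: a \<epsilon>)
  case 0
  then show ?case by simp
next
  case (Suc n)
  let ?a = "\<lambda>i. a (Suc i)" and ?\<epsilon> = "\<lambda>i. \<epsilon> (Suc i)"
  have "cfrac ?a ?\<epsilon> n = cf_num ?a ?\<epsilon> (Suc n) / cf_den ?a ?\<epsilon> (Suc n)"
    using Suc.prems[of "Suc _"] by (intro Suc.IH) simp
  \<comment> \<open>The numerator of the tail is the denominator of the whole fraction, so the outer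
    division is by a nonzero number.\<close>
  moreover have "cf_num ?a ?\<epsilon> (Suc n) \<noteq> 0"
    using Suc.prems[of 0 "Suc n"] by (simp only: cf_shift add_0_right not_False_eq_True)
  ultimately show ?case
    by (simp only: cf_shift[of a \<epsilon> "Suc n"] cfrac.simps) (simp add: field_simps)
qed

lemma of_int_mult_sqrt2_ge: "of_int k * sqrt 2 * y \<le> of_int l * sqrt 2 * y" if "k \<le> l" "0 \<le> y" for y :: real
  using that by (intro mult_right_mono) auto

section \<open>Digit rules and growth of the denominators\<close>

text \<open>Constraining only the indices from 1 on makes the rule hereditary: every tail of an
  expansion obeys it again, as \<open>cfrac_eq_cf\<close> requires.\<close>

definition rosen_rule :: "(nat \<Rightarrow> int) \<Rightarrow> (nat \<Rightarrow> real) \<Rightarrow> bool" where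
  "rosen_rule a \<epsilon> \<longleftrightarrow>
     (\<forall>i\<ge>1. a i \<ge> 1 \<and> (\<epsilon> i = 1 \<or> \<epsilon> i = -1) \<and> (a i = 1 \<longrightarrow> \<epsilon> (Suc i) = 1))"

definition dual_rosen_rule :: "(nat \<Rightarrow> int) \<Rightarrow> (nat \<Rightarrow> real) \<Rightarrow> bool" where
  "dual_rosen_rule a \<epsilon> \<longleftrightarrow>
     (\<forall>i\<ge>1. a i \<ge> 1 \<and> (\<epsilon> i = 1 \<or> \<epsilon> i = -1) \<and> (a i = 1 \<longrightarrow> \<epsilon> i = 1))"

text \<open>The third clause drives the induction: it keeps a subtracted denominator below
  \<open>sqrt 2 - 1\<close> times the next one. A digit 1 then still yields growth, and a negative
  sign after the digit forces it to be at least 2, which restores the factor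
  \<open>sqrt 2 + 1\<close>.\<close>

lemma rosen_den_growth:
  assumes "rosen_rule a \<epsilon>"
  shows "0 \<le> cf_den a \<epsilon> n \<and> cf_den a \<epsilon> n < cf_den a \<epsilon> (Suc n) \<and>
    (\<epsilon> (Suc n) = -1 \<longrightarrow> (sqrt 2 + 1) * cf_den a \<epsilon> n < cf_den a \<epsilon> (Suc n))"
proof (induction n)
  case 0
  then show ?case by simp
next
  case (Suc n)
  note w = sqrt2_bounds
  let ?S = "cf_den a \<epsilon> n" and ?T = "cf_den a \<epsilon> (Suc n)"
  have r: "a (Suc n) \<ge> 1" "\<epsilon> (Suc n) = 1 \<or> \<epsilon> (Suc n) = -1" "a (Suc n) = 1 \<longrightarrow> \<epsilon> (Suc (Suc n)) = 1"
    using assms by (simp_all add: rosen_rule_def)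
  have T: "0 < ?T" using Suc by linarith
  have "\<epsilon> (Suc n) * ?S > - (sqrt 2 - 1) * ?T"
    using r(2) T Suc by (intro sign_mult_gt) auto
  moreover have "(sqrt 2 - 1) * ?T = sqrt 2 * ?T - ?T" by (simp add: algebra_simps)
  ultimately have *: "cf_den a \<epsilon> (Suc (Suc n)) > of_int (a (Suc n)) * sqrt 2 * ?T - sqrt 2 * ?T + ?T"
    unfolding cf_den.simps by linarith
  have "sqrt 2 * ?T \<le> of_int (a (Suc n)) * sqrt 2 * ?T"
    using of_int_mult_sqrt2_ge[of 1 "a (Suc n)" ?T] r T by simp
  then have "?T < cf_den a \<epsilon> (Suc (Suc n))" using * by linarith
  moreover have "(sqrt 2 + 1) * ?T < cf_den a \<epsilon> (Suc (Suc n))" if "\<epsilon> (Suc (Suc n)) = -1"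
  proof -
    have "a (Suc n) \<ge> 2" using r that by force
    then have "2 * sqrt 2 * ?T \<le> of_int (a (Suc n)) * sqrt 2 * ?T"
      using of_int_mult_sqrt2_ge[of 2 "a (Suc n)" ?T] T by simp
    moreover have "(sqrt 2 + 1) * ?T = sqrt 2 * ?T + ?T" by (simp add: algebra_simps)
    ultimately show ?thesis using * by linarith
  qed
  ultimately show ?case using T by auto
qed

text \<open>Subtraction occurs only with a digit at least 2; then one of the two terms
  \<open>sqrt 2 * ?T\<close> absorbs the older denominator.\<close>

lemma dual_den_growth:
  assumes "dual_rosen_rule a \<epsilon>"
  shows "0 \<le> cf_den a \<epsilon> n \<and> 0 < cf_den a \<epsilon> (Suc n) \<and> sqrt 2 * cf_den a \<epsilon> n \<le> cf_den a \<epsilon> (Suc n)"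
proof (induction n)
  case 0
  then show ?case by simp
next
  case (Suc n)
  note w = sqrt2_bounds
  let ?S = "cf_den a \<epsilon> n" and ?T = "cf_den a \<epsilon> (Suc n)"
  have r: "a (Suc n) \<ge> 1" "\<epsilon> (Suc n) = 1 \<or> \<epsilon> (Suc n) = -1" "a (Suc n) = 1 \<longrightarrow> \<epsilon> (Suc n) = 1"
    using assms by (simp_all add: dual_rosen_rule_def)
  have T: "0 < ?T" using Suc by linarith
  have "sqrt 2 * ?T \<le> cf_den a \<epsilon> (Suc (Suc n))"
    using r(2)
  proof
    assume e: "\<epsilon> (Suc n) = 1"
    have "of_int (a (Suc n)) * sqrt 2 * ?T \<ge> of_int 1 * sqrt 2 * ?T"
      using r T by (intro of_int_mult_sqrt2_ge) auto
    moreover have "\<epsilon> (Suc n) * ?S = ?S" using e by simp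
    ultimately show ?thesis using Suc unfolding cf_den.simps by linarith
  next
    assume e: "\<epsilon> (Suc n) = -1"
    then have "a (Suc n) \<ge> 2" using r by force
    then have "of_int (a (Suc n)) * sqrt 2 * ?T \<ge> of_int 2 * sqrt 2 * ?T"
      using T by (intro of_int_mult_sqrt2_ge) auto
    moreover have "1 * ?S \<le> sqrt 2 * ?S" using Suc by (intro mult_right_mono) auto
    moreover have "1 * ?T \<le> sqrt 2 * ?T" using T by (intro mult_right_mono) auto
    moreover have "\<epsilon> (Suc n) * ?S = - ?S" using e by simp
    ultimately show ?thesis using Suc unfolding cf_den.simps by linarith
  qed
  moreover have "0 < sqrt 2 * ?T" using T by simp
  ultimately show ?case using T by linarith
qed

lemma rosen_cfrac:
  assumes "rosen_rule a \<epsilon>"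
  shows "cfrac a \<epsilon> n = cf_num a \<epsilon> (Suc n) / cf_den a \<epsilon> (Suc n)"
proof (rule cfrac_eq_cf)
  fix k n
  have "rosen_rule (\<lambda>i. a (i + k)) (\<lambda>i. \<epsilon> (i + k))"
    using assms by (simp add: rosen_rule_def)
  from rosen_den_growth[OF this, of n]
  show "cf_den (\<lambda>i. a (i + k)) (\<lambda>i. \<epsilon> (i + k)) (Suc n) \<noteq> 0" by auto
qed

lemma dual_rosen_cfrac:
  assumes "dual_rosen_rule a \<epsilon>"
  shows "cfrac a \<epsilon> n = cf_num a \<epsilon> (Suc n) / cf_den a \<epsilon> (Suc n)"
proof (rule cfrac_eq_cf)
  fix k n
  have "dual_rosen_rule (\<lambda>i. a (i + k)) (\<lambda>i. \<epsilon> (i + k))"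
    using assms by (simp add: dual_rosen_rule_def)
  from dual_den_growth[OF this, of n]
  show "cf_den (\<lambda>i. a (i + k)) (\<lambda>i. \<epsilon> (i + k)) (Suc n) \<noteq> 0" by auto
qed

lemma H4_column_error_nonzero:
  assumes "ereal \<alpha> \<notin> Q_H4" "H4_column p q"
  shows "q * \<alpha> - p \<noteq> 0"
proof
  assume "q * \<alpha> - p = 0"
  obtain r s where "p * s - r * q = 1" using assms(2) by (auto simp: H4_column_iff H4_matrix_def)
  then have "q \<noteq> 0" using \<open>q * \<alpha> - p = 0\<close> by auto
  then have "\<alpha> = p / q" using \<open>q * \<alpha> - p = 0\<close> by (simp add: field_simps)
  then have "ereal \<alpha> \<in> Q_H4" using \<open>q \<noteq> 0\<close> assms(2) by (force simp: Q_H4_def)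
  then show False using assms by simp
qed

section \<open>Matrices, errors and coordinates along an expansion\<close>

text \<open>Captures what both algorithms share. No condition on the choice of \<open>a n\<close>
  appears, so the locale is available before the digits are known to exist.\<close>

locale sqrt2_expansion =
  fixes \<alpha> :: real and a :: "nat \<Rightarrow> int" and \<epsilon> x :: "nat \<Rightarrow> real"
  assumes not_cusp: "ereal \<alpha> \<notin> Q_H4"
    and x_0: "x 0 = \<alpha>"
    and x_Suc: "x (Suc n) = 1 / \<bar>x n - of_int (a n) * sqrt 2\<bar>"
    and eps_Suc: "\<epsilon> (Suc n) = sgn (x n - of_int (a n) * sqrt 2)"
begin

abbreviation "num \<equiv> cf_num a \<epsilon>"
abbreviation "den \<equiv> cf_den a \<epsilon>"
definition "err n = den n * \<alpha> - num n"

lemma x_remainder: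
  assumes "x n \<noteq> of_int (a n) * sqrt 2"
  shows "x n - of_int (a n) * sqrt 2 = \<epsilon> (Suc n) / x (Suc n)" "x (Suc n) > 0"
    "\<epsilon> (Suc n) = 1 \<or> \<epsilon> (Suc n) = -1"
  using assms by (auto simp: x_Suc eps_Suc sgn_if abs_if)

text \<open>Both claims go through one induction: the matrix makes the error nonzero because
  \<alpha> is no cusp, the error formula then makes the remainder of \<open>x n\<close> nonzero, and
  so the next sign is 1 or -1 and the next matrix lies in the group. The sign \<sigma> keeps the
  determinant equal to 1.\<close>

lemma matrix_and_error:
  "(\<exists>\<sigma>. (\<sigma> = 1 \<or> \<sigma> = -1) \<and> H4_matrix (num (Suc n)) (\<sigma> * num n) (den (Suc n)) (\<sigma> * den n)) \<and>
   err (Suc n) = (of_int (a n) * sqrt 2 - x n) * err n"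
proof (induction n)
  case 0
  have "H4_matrix (of_int (a 0) * sqrt 2) (- 1) 1 (- 0)"
    using H4_matrix_swap[OF H4_matrix_translate[OF H4_matrix_one, of "a 0"]] by simp
  then show ?case by (auto simp: err_def x_0 intro!: exI[of _ "-1"])
next
  case (Suc n)
  then obtain \<sigma> where \<sigma>: "\<sigma> = 1 \<or> \<sigma> = -1"
    and M: "H4_matrix (num (Suc n)) (\<sigma> * num n) (den (Suc n)) (\<sigma> * den n)" by blast
  have E: "err (Suc n) = (of_int (a n) * sqrt 2 - x n) * err n" using Suc by blast
  have "err (Suc n) \<noteq> 0"
    using H4_column_error_nonzero[OF not_cusp H4_matrix_columnD[OF M]] by (simp add: err_def)
  then have ne: "x n \<noteq> of_int (a n) * sqrt 2" using E by auto
  note rem = x_remainder[OF ne]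
  have "err (Suc n) = - (\<epsilon> (Suc n) / x (Suc n)) * err n"
    using E rem(1) by (metis minus_diff_eq)
  then have rel: "\<epsilon> (Suc n) * err n = - x (Suc n) * err (Suc n)"
    using rem(2) by (simp add: field_simps)
  have "err (Suc (Suc n)) = of_int (a (Suc n)) * sqrt 2 * err (Suc n) + \<epsilon> (Suc n) * err n"
    by (simp add: err_def algebra_simps)
  then have E': "err (Suc (Suc n)) = (of_int (a (Suc n)) * sqrt 2 - x (Suc n)) * err (Suc n)"
    using rel by (simp add: algebra_simps)
  define \<tau> where "\<tau> = \<sigma> * \<epsilon> (Suc n)"
  have \<tau>: "\<tau> = 1 \<or> \<tau> = -1" using \<sigma> rem(3) by (auto simp: \<tau>_def)
  obtain k :: int where k: "of_int k = \<tau> * of_int (a (Suc n))"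
    using \<tau> by (metis mult_1 mult_minus1 of_int_minus)
  have "\<sigma> = \<tau> * \<epsilon> (Suc n)" using rem(3) by (auto simp: \<tau>_def)
  then have "\<sigma> * num n + of_int k * sqrt 2 * num (Suc n) = \<tau> * num (Suc (Suc n))"
    "\<sigma> * den n + of_int k * sqrt 2 * den (Suc n) = \<tau> * den (Suc (Suc n))"
    unfolding k by (simp_all add: algebra_simps)
  then have M': "H4_matrix (\<tau> * num (Suc (Suc n))) (- num (Suc n)) (\<tau> * den (Suc (Suc n))) (- den (Suc n))"
    using H4_matrix_swap[OF H4_matrix_translate[OF M, of k]] by (simp only:)
  have "H4_matrix (num (Suc (Suc n))) (- \<tau> * num (Suc n)) (den (Suc (Suc n))) (- \<tau> * den (Suc n))"
    using \<tau>
  proof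
    assume "\<tau> = 1" then show ?thesis using M' by (simp only: mult_1 mult_minus_left)
  next
    assume "\<tau> = -1" then show ?thesis using H4_matrix_uminus[OF M']
      by (simp only: mult_1 mult_minus_left minus_minus)
  qed
  moreover have "- \<tau> = 1 \<or> - \<tau> = -1" using \<tau> by auto
  ultimately show ?case using E' by blast
qed

lemma matrix:
  obtains \<sigma> where "\<sigma> = 1 \<or> \<sigma> = -1"
    "H4_matrix (num (Suc n)) (\<sigma> * num n) (den (Suc n)) (\<sigma> * den n)"
  using matrix_and_error[of n] by blast

lemma err_Suc: "err (Suc n) = (of_int (a n) * sqrt 2 - x n) * err n"
  using matrix_and_error[of n] by blast

lemma column: "H4_column (num n) (den n)"
proof (cases n)
  case 0
  then show ?thesis using H4_matrix_columnD[OF H4_matrix_one] by simp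
next
  case (Suc m)
  then show ?thesis by (metis H4_matrix_columnD matrix)
qed

lemma err_nonzero: "err n \<noteq> 0"
  using H4_column_error_nonzero[OF not_cusp column] by (simp add: err_def)

lemma x_neq: "x n \<noteq> of_int (a n) * sqrt 2"
  using err_Suc[of n] err_nonzero[of "Suc n"] by auto

lemma x_eq: "x n = of_int (a n) * sqrt 2 + \<epsilon> (Suc n) / x (Suc n)"
  using x_remainder(1)[OF x_neq, of n] by simp

lemma x_pos: "x (Suc n) > 0"
  and eps_cases: "\<epsilon> (Suc n) = 1 \<or> \<epsilon> (Suc n) = -1"
  using x_remainder[OF x_neq, of n] by auto

lemma err_prev: "err n = - \<epsilon> (Suc n) * x (Suc n) * err (Suc n)"
proof -
  have "err (Suc n) = - (\<epsilon> (Suc n) / x (Suc n)) * err n"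
    using err_Suc[of n] x_eq[of n] by simp
  then show ?thesis using x_pos[of n] eps_cases[of n] by (auto simp: field_simps)
qed

text \<open>The boundary values of the Rosen digits would make \<open>\<alpha>\<close> a cusp of the group.\<close>
lemma x_not_half_integer: "x n \<noteq> of_int k * sqrt 2 + 1 / sqrt 2"
proof
  assume x: "x n = of_int k * sqrt 2 + 1 / sqrt 2"
  obtain \<sigma> where \<sigma>: "\<sigma> = 1 \<or> \<sigma> = -1"
    "H4_matrix (num (Suc n)) (\<sigma> * num n) (den (Suc n)) (\<sigma> * den n)" by (rule matrix)
  define l :: real where "l = of_int (k - a n)"
  obtain j :: int where j: "of_int j = \<sigma> * l"
    using \<sigma>(1) unfolding l_def by (metis mult_1 mult_minus1 of_int_minus)
  obtain i :: int where i: "of_int i = \<sigma>"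
    using \<sigma>(1) by (metis of_int_1 of_int_minus)
  have \<sigma>\<sigma>: "\<sigma> * (\<sigma> * y) = y" for y using \<sigma>(1) by auto
  \<comment> \<open>\<open>U / V\<close> is the convergent with last digit \<open>k\<close> in place
    of \<open>a n\<close>. Appending a further digit 1 replaces the complete quotient by
    \<open>k * sqrt 2 + 1 / sqrt 2\<close>, so the resulting column has error zero.\<close>
  define U V where "U = num (Suc n) + l * sqrt 2 * num n" "V = den (Suc n) + l * sqrt 2 * den n"
  have "H4_matrix (\<sigma> * num n) (- U) (\<sigma> * den n) (- V)"
    using H4_matrix_translate[OF H4_matrix_swap[OF \<sigma>(2)], of "-j"]
    by (simp add: j U_V_def algebra_simps \<sigma>\<sigma>)
  from H4_matrix_swap[OF H4_matrix_translate[OF H4_matrix_swap[OF this], of i]]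
  have "H4_column (- \<sigma> * (num n + sqrt 2 * U)) (- \<sigma> * (den n + sqrt 2 * V))"
    by (intro H4_matrix_columnD) (simp add: i algebra_simps)
  from H4_column_error_nonzero[OF not_cusp this]
  have "- \<sigma> * ((den n + sqrt 2 * V) * \<alpha> - (num n + sqrt 2 * U)) \<noteq> 0"
    by (simp add: algebra_simps)
  moreover have "(den n + sqrt 2 * V) * \<alpha> - (num n + sqrt 2 * U) =
      err n + sqrt 2 * (err (Suc n) + l * sqrt 2 * err n)"
    by (simp add: U_V_def err_def algebra_simps)
  also have "\<dots> = (1 + sqrt 2 * (of_int k * sqrt 2 - x n)) * err n"
    by (simp add: err_Suc l_def algebra_simps)
  also have "\<dots> = 0" unfolding x by simp
  ultimately show False by simp
qed

text \<open>The sign \<sigma> of the matrix is absorbed into \<open>m\<close>, which is why only the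
  size of \<open>m\<close> is given by a determinant. The error is linear in the column, and
  \<open>err_prev\<close> expresses the older error through the newer one.\<close>

lemma coordinates:
  assumes "H4_column p q"
  obtains m n where "p = m * num k + n * num (Suc k)" "q = m * den k + n * den (Suc k)"
    "hecke_pair m n" "m = 0 \<Longrightarrow> \<bar>n\<bar> = 1" "\<bar>m\<bar> = \<bar>num (Suc k) * q - den (Suc k) * p\<bar>"
    "\<bar>q * \<alpha> - p\<bar> = \<bar>m * x (Suc k) - \<epsilon> (Suc k) * n\<bar> * \<bar>err (Suc k)\<bar>"
proof -
  obtain \<sigma> where \<sigma>: "\<sigma> = 1 \<or> \<sigma> = -1"
    "H4_matrix (num (Suc k)) (\<sigma> * num k) (den (Suc k)) (\<sigma> * den k)" by (rule matrix)
  obtain m n where mn: "p = m * (\<sigma> * num k) + n * num (Suc k)" "q = m * (\<sigma> * den k) + n * den (Suc k)"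
    "hecke_pair m n" "m = 0 \<Longrightarrow> \<bar>n\<bar> = 1" "m = num (Suc k) * q - den (Suc k) * p"
    by (rule H4_coordinates[OF \<sigma>(2) assms]) blast
  have pair: "hecke_pair (\<sigma> * m) n"
    using mn(3) \<sigma>(1) unfolding hecke_pair_def
    by (metis mult_1 mult_minus1 mult_minus_right of_int_minus)
  have "q * \<alpha> - p = \<sigma> * m * err k + n * err (Suc k)"
    by (simp add: mn(1,2) err_def algebra_simps)
  also have "\<dots> = (n - \<epsilon> (Suc k) * (\<sigma> * m * x (Suc k))) * err (Suc k)"
    by (subst err_prev) (simp add: algebra_simps)
  also have "\<bar>\<dots>\<bar> = \<bar>\<sigma> * m * x (Suc k) - \<epsilon> (Suc k) * n\<bar> * \<bar>err (Suc k)\<bar>"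
    using eps_cases[of k] by (auto simp: abs_mult)
  finally have "\<bar>q * \<alpha> - p\<bar> = \<bar>\<sigma> * m * x (Suc k) - \<epsilon> (Suc k) * n\<bar> * \<bar>err (Suc k)\<bar>" .
  moreover have "\<bar>\<sigma> * m\<bar> = \<bar>num (Suc k) * q - den (Suc k) * p\<bar>" using \<sigma>(1) mn(5) by auto
  ultimately show ?thesis using pair mn(1,2,4) \<sigma>(1)
    by (intro that[of "\<sigma> * m" n]) (auto simp: algebra_simps)
qed

end

lemma H4_column_hecke_pair: "H4_column p q \<Longrightarrow> hecke_pair p q"
  by (auto simp: H4_column_iff dest: H4_matrix_hecke_type hecke_type_columnD)

lemma H4_fraction_den_ge_1: "H4_fraction p q \<Longrightarrow> q \<ge> 1"
  using hecke_pair_abs_ge_1[of q p] H4_column_hecke_pair[of p q]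
  by (auto simp: H4_fraction_def hecke_pair_commute)

text \<open>Since squares of entries are integers, a strictly increasing sequence of denominators
  has squares growing by at least 1 and is unbounded.\<close>

lemma hecke_pair_square:
  assumes "hecke_pair m n"
  obtains N :: int where "n\<^sup>2 = of_int N"
proof -
  obtain c :: int where "n = sqrt 2 * of_int c \<or> n = of_int c"
    using assms unfolding hecke_pair_def by blast
  then show ?thesis
  proof
    assume "n = sqrt 2 * of_int c"
    then show ?thesis by (intro that[of "2 * c\<^sup>2"]) (simp add: power_mult_distrib)
  next
    assume "n = of_int c"
    then show ?thesis by (intro that[of "c\<^sup>2"]) simp
  qed
qed

context sqrt2_expansion
begin

lemma det: "\<bar>num (Suc n) * den n - den (Suc n) * num n\<bar> = 1"
proof -
  obtain \<sigma> where \<sigma>: "\<sigma> = 1 \<or> \<sigma> = -1"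
    "H4_matrix (num (Suc n)) (\<sigma> * num n) (den (Suc n)) (\<sigma> * den n)" by (rule matrix)
  then have "\<sigma> * (num (Suc n) * den n - den (Suc n) * num n) = 1"
    by (simp add: H4_matrix_def algebra_simps)
  then have "\<bar>\<sigma>\<bar> * \<bar>num (Suc n) * den n - den (Suc n) * num n\<bar> = 1"
    by (simp flip: abs_mult)
  then show ?thesis using \<sigma>(1) by auto
qed

lemma fraction_unique:
  assumes "H4_fraction p q" "0 < den (Suc k)" "p / q = num (Suc k) / den (Suc k)"
  shows "p = num (Suc k) \<and> q = den (Suc k)"
proof -
  have q: "0 < q" "H4_column p q" using assms by (auto simp: H4_fraction_def)
  obtain m n where mn: "p = m * num k + n * num (Suc k)" "q = m * den k + n * den (Suc k)"
    "m = 0 \<Longrightarrow> \<bar>n\<bar> = 1" "\<bar>m\<bar> = \<bar>num (Suc k) * q - den (Suc k) * p\<bar>"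
    by (rule coordinates[OF q(2)]) blast
  have "num (Suc k) * q = den (Suc k) * p" using assms(2,3) q by (simp add: field_simps)
  then have m: "m = 0" using mn(4) by simp
  then have "n > 0" using mn(2) q assms(2) by (simp add: zero_less_mult_iff)
  then show ?thesis using mn m by simp
qed

text \<open>In these coordinates the convergent itself is \<open>(0, 1)\<close> with relative error
  1, which explains the bound in \<open>gt\<close>; a competitor with \<open>m = 0\<close> would be
  the same fraction.\<close>

lemma best_approximation_convergent:
  assumes frac: "H4_fraction p q" and pos: "0 < den (Suc k)"
    and eq: "p / q = num (Suc k) / den (Suc k)"
    and gt: "\<And>m n. hecke_pair m n \<Longrightarrow> m \<noteq> 0 \<Longrightarrow> 0 < m * den k + n * den (Suc k) \<Longrightarrow>
      m * den k + n * den (Suc k) \<le> den (Suc k) \<Longrightarrow> \<bar>m * x (Suc k) - \<epsilon> (Suc k) * n\<bar> > 1"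
  shows "H4_best_approximation \<alpha> p q"
  unfolding H4_best_approximation_def
proof (intro conjI allI impI frac)
  note pq = fraction_unique[OF frac pos eq]
  fix r s assume rs: "H4_fraction r s \<and> r / s \<noteq> p / q \<and> 0 < s \<and> s \<le> q"
  then have col: "H4_column r s" by (simp add: H4_fraction_def)
  obtain m n where mn: "r = m * num k + n * num (Suc k)" "s = m * den k + n * den (Suc k)"
    "hecke_pair m n" "\<bar>m\<bar> = \<bar>num (Suc k) * s - den (Suc k) * r\<bar>"
    "\<bar>s * \<alpha> - r\<bar> = \<bar>m * x (Suc k) - \<epsilon> (Suc k) * n\<bar> * \<bar>err (Suc k)\<bar>"
    by (rule coordinates[OF col]) blast
  have "m \<noteq> 0"
  proof
    assume "m = 0"
    then have "r * den (Suc k) = num (Suc k) * s" using mn(4) by simp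
    moreover have "s \<noteq> 0" "den (Suc k) \<noteq> 0" using rs pos by auto
    ultimately have "r / s = num (Suc k) / den (Suc k)" by (metis frac_eq_eq)
    then have "r / s = p / q" using pq by simp
    then show False using rs by simp
  qed
  then have "\<bar>m * x (Suc k) - \<epsilon> (Suc k) * n\<bar> > 1"
    using gt[OF mn(3)] rs pq unfolding mn(2) by simp
  then have "1 * \<bar>err (Suc k)\<bar> < \<bar>s * \<alpha> - r\<bar>"
    unfolding mn(5) using err_nonzero by (intro mult_strict_right_mono) auto
  then show "\<bar>q * \<alpha> - p\<bar> < \<bar>s * \<alpha> - r\<bar>" using pq by (simp add: err_def)
qed

lemma best_approximation_bracket:
  assumes best: "H4_best_approximation \<alpha> p q"
    and den: "\<And>n. 0 < den (Suc n)" "\<And>n. den (Suc n) < den (Suc (Suc n))"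
  obtains k where "den (Suc k) \<le> q" "q < den (Suc (Suc k))"
proof -
  have "q \<ge> 1" using best H4_fraction_den_ge_1 by (auto simp: H4_best_approximation_def)
  have sq: "(den (Suc n))\<^sup>2 \<ge> real n" for n
  proof (induction n)
    case (Suc n)
    obtain N N' :: int where N: "(den (Suc n))\<^sup>2 = of_int N" "(den (Suc (Suc n)))\<^sup>2 = of_int N'"
      using hecke_pair_square H4_column_hecke_pair[OF column] by metis
    have "(den (Suc n))\<^sup>2 < (den (Suc (Suc n)))\<^sup>2"
      using den less_imp_le by (intro power_strict_mono) auto
    then have "N < N'" unfolding N by simp
    then have "real_of_int N + 1 \<le> real_of_int N'" by linarith
    then show ?case using Suc unfolding N by simp
  qed simp
  obtain n :: nat where "q\<^sup>2 < real n" using reals_Archimedean2 by blast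
  then have "q\<^sup>2 < (den (Suc n))\<^sup>2" using sq[of n] by linarith
  then have ex: "\<exists>n. q < den (Suc n)" using den(1) power_less_imp_less_base less_imp_le by blast
  define l where "l = (LEAST n. q < den (Suc n))"
  have l: "q < den (Suc l)" unfolding l_def using ex by (rule LeastI_ex)
  have "l \<noteq> 0" using l \<open>q \<ge> 1\<close> by (intro notI) simp
  then obtain k where k: "l = Suc k" using not0_implies_Suc by blast
  have "\<not> q < den (Suc k)" using not_less_Least[of k "\<lambda>n. q < den (Suc n)"] k l_def by simp
  then show ?thesis using that[of k] l k by simp
qed

text \<open>The convergent with denominator \<open>den (Suc k) \<le> q\<close> is a competitor, so
  its error exceeds that of \<open>p / q\<close>. Relative to the next error it equals
  \<open>x (Suc (Suc k))\<close>, the bound obtained here.\<close>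

lemma best_approximation_coordinates:
  assumes best: "H4_best_approximation \<alpha> p q"
    and den: "0 < den (Suc k)" "den (Suc k) \<le> q"
    and neq: "p / q \<noteq> num (Suc k) / den (Suc k)"
  obtains m n where "p = m * num (Suc k) + n * num (Suc (Suc k))"
    "q = m * den (Suc k) + n * den (Suc (Suc k))" "hecke_pair m n"
    "\<bar>m * x (Suc (Suc k)) - \<epsilon> (Suc (Suc k)) * n\<bar> < x (Suc (Suc k))"
proof -
  have "H4_column p q" using best by (simp add: H4_best_approximation_def H4_fraction_def)
  then obtain m n where mn: "p = m * num (Suc k) + n * num (Suc (Suc k))"
    "q = m * den (Suc k) + n * den (Suc (Suc k))" "hecke_pair m n"
    "\<bar>q * \<alpha> - p\<bar> = \<bar>m * x (Suc (Suc k)) - \<epsilon> (Suc (Suc k)) * n\<bar> * \<bar>err (Suc (Suc k))\<bar>"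
    by (rule coordinates[where k = "Suc k"]) blast
  have "H4_fraction (num (Suc k)) (den (Suc k))" using column den by (simp add: H4_fraction_def)
  then have "\<bar>q * \<alpha> - p\<bar> < \<bar>err (Suc k)\<bar>"
    using best den neq[symmetric] unfolding H4_best_approximation_def err_def by blast
  also have "\<bar>err (Suc k)\<bar> = x (Suc (Suc k)) * \<bar>err (Suc (Suc k))\<bar>"
    using err_prev[of "Suc k"] x_pos[of "Suc k"] eps_cases[of "Suc k"] by (auto simp: abs_mult)
  finally have "\<bar>m * x (Suc (Suc k)) - \<epsilon> (Suc (Suc k)) * n\<bar> < x (Suc (Suc k))"
    unfolding mn(4) using err_nonzero[of "Suc (Suc k)"] by simp
  then show ?thesis using that mn by blast
qed

end

section \<open>Rosen and dual Rosen expansions\<close>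

locale rosen_expansion = sqrt2_expansion +
  assumes near: "of_int (a n) * sqrt 2 - 1 / sqrt 2 < x n" "x n < of_int (a n) * sqrt 2 + 1 / sqrt 2"
begin

lemma x_gt: "x (Suc n) > sqrt 2"
proof -
  have "\<bar>x n - of_int (a n) * sqrt 2\<bar> < 1 / sqrt 2" using near[of n] by linarith
  moreover have "\<bar>x n - of_int (a n) * sqrt 2\<bar> > 0" using x_neq[of n] by simp
  ultimately have "1 / (1 / sqrt 2) < x (Suc n)" unfolding x_Suc by (intro divide_strict_left_mono) auto
  then show ?thesis by simp
qed

lemma rule: "rosen_rule a \<epsilon>"
  unfolding rosen_rule_def
proof (intro allI impI)
  fix i :: nat assume "i \<ge> 1"
  then obtain n where i: "i = Suc n" using not0_implies_Suc by fastforce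
  have h: "1 / sqrt 2 = sqrt 2 / (2::real)" by (simp add: field_simps)
  have "0 < of_int (a i) * sqrt 2" using near(2)[of i] x_gt[of n] sqrt2_bounds unfolding h i by linarith
  then have "a i \<ge> 1" by (simp add: zero_less_mult_iff)
  moreover have "\<epsilon> (Suc i) = 1" if "a i = 1" using that x_gt[of n] unfolding i by (simp add: eps_Suc)
  ultimately show "a i \<ge> 1 \<and> (\<epsilon> i = 1 \<or> \<epsilon> i = -1) \<and> (a i = 1 \<longrightarrow> \<epsilon> (Suc i) = 1)"
    using eps_cases[of n] i by auto
qed

lemma den_growth: "0 \<le> den n" "den n < den (Suc n)"
    "\<epsilon> (Suc n) = -1 \<Longrightarrow> (sqrt 2 + 1) * den n < den (Suc n)"
  using rosen_den_growth[OF rule, of n] by auto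

lemma den_pos: "0 < den (Suc n)"
  using den_growth(1,2)[of n] by linarith

lemma best_approximation:
  assumes "H4_fraction p q" "p / q = num (Suc k) / den (Suc k)"
  shows "H4_best_approximation \<alpha> p q"
  using assms(1) den_pos assms(2)
proof (rule best_approximation_convergent)
  fix m n assume "hecke_pair m n" "m \<noteq> 0" "0 < m * den k + n * den (Suc k)"
    "m * den k + n * den (Suc k) \<le> den (Suc k)"
  with den_growth x_gt eps_cases show "\<bar>m * x (Suc k) - \<epsilon> (Suc k) * n\<bar> > 1"
    by (intro rosen_error_gt[where S = "den k" and T = "den (Suc k)"])
qed

text \<open>\<open>rosen_intermediate\<close> leaves a single column between two convergents. The
  conclusion \<open>q > 1\<close> keeps it apart from the dual convergent of index 0, which has
  denominator 1.\<close>

lemma non_convergent_best_approximation: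
  assumes best: "H4_best_approximation \<alpha> p q" and neq: "\<And>k. p / q \<noteq> num (Suc k) / den (Suc k)"
  obtains k where "p = num (Suc (Suc k)) - sqrt 2 * num (Suc k)" "q = den (Suc (Suc k)) - sqrt 2 * den (Suc k)"
    "\<epsilon> (Suc (Suc k)) = -1" "q > 1"
proof -
  obtain k where k: "den (Suc k) \<le> q" "q < den (Suc (Suc k))"
    using best_approximation_bracket[OF best den_pos den_growth(2)] by blast
  obtain m n where mn: "p = m * num (Suc k) + n * num (Suc (Suc k))"
    "q = m * den (Suc k) + n * den (Suc (Suc k))" "hecke_pair m n"
    "\<bar>m * x (Suc (Suc k)) - \<epsilon> (Suc (Suc k)) * n\<bar> < x (Suc (Suc k))"
    by (rule best_approximation_coordinates[OF best den_pos k(1) neq]) blast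
  have q: "0 < m * den (Suc k) + n * den (Suc (Suc k))" "m * den (Suc k) + n * den (Suc (Suc k)) < den (Suc (Suc k))"
    using mn(2) k den_pos[of k] by linarith+
  have *: "\<epsilon> (Suc (Suc k)) = -1 \<and> x (Suc (Suc k)) < sqrt 2 + 1 \<and> m = - sqrt 2 \<and> n = 1"
    using rosen_intermediate[OF mn(3) den_pos den_growth(2) x_gt eps_cases den_growth(3) q mn(4)] by blast
  have "(sqrt 2 + 1) * den (Suc k) < den (Suc (Suc k))" using den_growth(3) * by blast
  then have "den (Suc k) < q" using mn(2) * by (simp add: algebra_simps)
  moreover have "1 \<le> den (Suc k)"
    using H4_fraction_den_ge_1[of "num (Suc k)"] column den_pos by (simp add: H4_fraction_def)
  ultimately show ?thesis using that[of k] mn(1,2) * by simp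
qed

end

locale dual_rosen_expansion = sqrt2_expansion +
  assumes near: "(of_int (a n) - 1) * sqrt 2 + 1 \<le> x n" "x n < of_int (a n) * sqrt 2 + 1"
begin

lemma x_gt: "x (Suc n) > 1"
proof -
  have "\<bar>x n - of_int (a n) * sqrt 2\<bar> < 1" using near[of n] sqrt2_bounds by (simp add: algebra_simps)
  moreover have "\<bar>x n - of_int (a n) * sqrt 2\<bar> > 0" using x_neq[of n] by simp
  ultimately have "1 / 1 < x (Suc n)" unfolding x_Suc by (intro divide_strict_left_mono) auto
  then show ?thesis by simp
qed

lemma x_ge: "\<epsilon> (Suc n) = -1 \<Longrightarrow> sqrt 2 + 1 \<le> x (Suc n)"
proof -
  assume "\<epsilon> (Suc n) = -1"
  then have "1 / x (Suc n) \<le> sqrt 2 - 1" using x_eq[of n] near(1)[of n] by (simp add: algebra_simps)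
  then have "1 \<le> (sqrt 2 - 1) * x (Suc n)" using x_pos[of n] by (simp add: field_simps)
  then have "(sqrt 2 + 1) * 1 \<le> (sqrt 2 + 1) * ((sqrt 2 - 1) * x (Suc n))"
    by (intro mult_left_mono) auto
  then show ?thesis by (simp add: algebra_simps)
qed

lemma rule: "dual_rosen_rule a \<epsilon>"
  unfolding dual_rosen_rule_def
proof (intro allI impI)
  fix i :: nat assume "i \<ge> 1"
  then obtain n where i: "i = Suc n" using not0_implies_Suc by fastforce
  have "0 < of_int (a i) * sqrt 2" using near(2)[of i] x_gt[of n] unfolding i by linarith
  then have "a i \<ge> 1" by (simp add: zero_less_mult_iff)
  moreover have "\<epsilon> i \<noteq> -1" if "a i = 1"
    using that x_ge[of n] near(2)[of i] unfolding i by auto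
  ultimately show "a i \<ge> 1 \<and> (\<epsilon> i = 1 \<or> \<epsilon> i = -1) \<and> (a i = 1 \<longrightarrow> \<epsilon> i = 1)"
    using eps_cases[of n] i by auto
qed

lemma den_growth: "0 \<le> den n" "0 < den (Suc n)" "sqrt 2 * den n \<le> den (Suc n)"
  using dual_den_growth[OF rule, of n] by auto

lemma den_increasing: "den (Suc n) < den (Suc (Suc n))"
proof -
  have "1 * den (Suc n) < sqrt 2 * den (Suc n)" using den_growth(2) by (intro mult_strict_right_mono) auto
  then show ?thesis using den_growth(3)[of "Suc n"] by linarith
qed

text \<open>
  Descent: a small ratio of denominators at the boundary value \<open>x = \<surd>2 + 1\<close> would require the previous
  digit to be \<open>2\<close> with sign \<open>-1\<close>, hence again the boundary value and a small ratio one step earlier.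
\<close>
lemma den_growth_boundary:
  "\<epsilon> (Suc n) = -1 \<Longrightarrow> x (Suc n) = sqrt 2 + 1 \<Longrightarrow> (sqrt 2 + 1) * den n < den (Suc n)"
proof (induction n)
  case 0
  then show ?case by simp
next
  case (Suc n)
  note w = sqrt2_bounds
  let ?S = "den n" and ?T = "den (Suc n)"
  have T: "0 < ?T" "0 \<le> ?S" and ST: "sqrt 2 * ?S \<le> ?T" using den_growth[of n] by auto
  have "sqrt 2 + 1 \<noteq> (0::real)" using w by linarith
  then have "1 / (sqrt 2 + 1) = sqrt 2 - (1::real)" by (subst divide_eq_eq) (simp add: algebra_simps)
  then have x: "x (Suc n) = of_int (a (Suc n)) * sqrt 2 - (sqrt 2 - 1)"
    using x_eq[of "Suc n"] Suc.prems by simp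
  \<comment> \<open>Digit 1 would give \<open>x (Suc n) = 1\<close>; from 3 on the digit alone makes
    the ratio large enough.\<close>
  have "a (Suc n) \<noteq> 1" using x x_gt[of n] by auto
  moreover have "a (Suc n) \<ge> 1" using rule by (simp add: dual_rosen_rule_def)
  ultimately consider "a (Suc n) = 2" | "a (Suc n) \<ge> 3" by linarith
  then show ?case
  proof cases
    case 1
    then have x': "x (Suc n) = sqrt 2 + 1" using x by simp
    have "\<epsilon> (Suc n) * ?S > - (sqrt 2 - 1) * ?T"
      using eps_cases[of n] T Suc.IH[OF _ x'] by (intro sign_mult_gt) auto
    then show ?thesis using 1 by (simp add: algebra_simps)
  next
    case 2
    then have "of_int (a (Suc n)) * sqrt 2 * ?T \<ge> of_int 3 * sqrt 2 * ?T"
      using T by (intro of_int_mult_sqrt2_ge) auto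
    moreover have "\<epsilon> (Suc n) * ?S \<ge> - ?S" using eps_cases[of n] T by auto
    moreover have "1 * ?S \<le> sqrt 2 * ?S" using T by (intro mult_right_mono) auto
    moreover have "1 * ?T < sqrt 2 * ?T" using T by (intro mult_strict_right_mono) auto
    moreover have "(sqrt 2 + 1) * ?T = sqrt 2 * ?T + ?T" by (simp add: algebra_simps)
    ultimately show ?thesis using ST T unfolding cf_den.simps by linarith
  qed
qed

text \<open>Index 0 is left out because \<open>a 0 * sqrt 2\<close> may be more than
  \<open>1 / sqrt 2\<close> away from \<alpha>; another multiple of \<open>sqrt 2\<close>, also with
  denominator 1, is then closer.\<close>

lemma best_approximation:
  assumes "H4_fraction p q" "p / q = num (Suc (Suc k)) / den (Suc (Suc k))"
  shows "H4_best_approximation \<alpha> p q"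
  using assms(1) den_growth(2) assms(2)
proof (rule best_approximation_convergent)
  fix m n assume "hecke_pair m n" "m \<noteq> 0" "0 < m * den (Suc k) + n * den (Suc (Suc k))"
    "m * den (Suc k) + n * den (Suc (Suc k)) \<le> den (Suc (Suc k))"
  with den_growth x_gt eps_cases x_ge den_growth_boundary
  show "\<bar>m * x (Suc (Suc k)) - \<epsilon> (Suc (Suc k)) * n\<bar> > 1"
    by (intro dual_error_gt[where S = "den (Suc k)" and T = "den (Suc (Suc k))"])
qed

lemma non_convergent_best_approximation:
  assumes best: "H4_best_approximation \<alpha> p q" and neq: "\<And>k. p / q \<noteq> num (Suc k) / den (Suc k)"
  obtains k where "p = sqrt 2 * num (Suc (Suc k)) - num (Suc k)" "q = sqrt 2 * den (Suc (Suc k)) - den (Suc k)"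
    "\<epsilon> (Suc (Suc k)) = -1" "den (Suc (Suc k)) < (sqrt 2 + 1) * den (Suc k)"
proof -
  obtain k where k: "den (Suc k) \<le> q" "q < den (Suc (Suc k))"
    using best_approximation_bracket[OF best den_growth(2) den_increasing] by blast
  obtain m n where mn: "p = m * num (Suc k) + n * num (Suc (Suc k))"
    "q = m * den (Suc k) + n * den (Suc (Suc k))" "hecke_pair m n"
    "\<bar>m * x (Suc (Suc k)) - \<epsilon> (Suc (Suc k)) * n\<bar> < x (Suc (Suc k))"
    by (rule best_approximation_coordinates[OF best den_growth(2) k(1) neq]) blast
  have q: "0 < m * den (Suc k) + n * den (Suc (Suc k))" "m * den (Suc k) + n * den (Suc (Suc k)) < den (Suc (Suc k))"
    using mn(2) k den_growth(2)[of k] by linarith+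
  have "\<epsilon> (Suc (Suc k)) = -1 \<and> den (Suc (Suc k)) < (sqrt 2 + 1) * den (Suc k) \<and> m = -1 \<and> n = sqrt 2"
    using dual_intermediate[OF mn(3) den_growth(2) den_growth(3) x_gt eps_cases x_ge q mn(4)] by blast
  then show ?thesis using that[of k] mn(1,2) by simp
qed

end

text \<open>\<open>sqrt2_expansion\<close> is interpreted first, since it supplies
  \<open>x_not_half_integer\<close>; only with the endpoints excluded does \<open>THE\<close> in
  \<open>rosen_digit\<close> denote a digit.\<close>

lemma rosen_expansion_rosen:
  assumes "ereal \<alpha> \<notin> Q_H4"
  shows "rosen_expansion \<alpha> (rosen_a \<alpha>) (rosen_eps \<alpha>) (rosen_x \<alpha>)"
proof -
  interpret sqrt2_expansion \<alpha> "rosen_a \<alpha>" "rosen_eps \<alpha>" "rosen_x \<alpha>"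
    by unfold_locales (simp_all add: assms rosen_a_def rosen_eps_def)
  have h: "1 / sqrt 2 = sqrt 2 / (2::real)" by (simp add: field_simps)
  have "of_int (rosen_digit y) * sqrt 2 - 1 / sqrt 2 < y \<and> y < of_int (rosen_digit y) * sqrt 2 + 1 / sqrt 2"
    if y: "\<And>k :: int. y \<noteq> of_int k * sqrt 2 + 1 / sqrt 2" for y
  proof -
    define k where "k = \<lfloor>y / sqrt 2 + 1 / 2\<rfloor>"
    have "of_int k \<le> y / sqrt 2 + 1 / 2" "y / sqrt 2 + 1 / 2 < of_int k + 1" unfolding k_def by linarith+
    then have "of_int k * sqrt 2 \<le> y + sqrt 2 / 2" "y + sqrt 2 / 2 < (of_int k + 1) * sqrt 2"
      by (simp_all add: field_simps)
    \<comment> \<open>The floor admits the left endpoint for \<open>k\<close>; it is the right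
      endpoint for \<open>k - 1\<close>, hence excluded.\<close>
    moreover have "y \<noteq> of_int (k - 1) * sqrt 2 + 1 / sqrt 2" by (rule y)
    ultimately have ex: "of_int k * sqrt 2 - 1 / sqrt 2 < y \<and> y < of_int k * sqrt 2 + 1 / sqrt 2"
      unfolding h by (simp add: algebra_simps)
    have uniq: "j = k" if "of_int j * sqrt 2 - 1 / sqrt 2 < y \<and> y < of_int j * sqrt 2 + 1 / sqrt 2"
      "of_int k * sqrt 2 - 1 / sqrt 2 < y \<and> y < of_int k * sqrt 2 + 1 / sqrt 2" for j k :: int
    proof -
      have "of_int j * sqrt 2 < (of_int k + 1) * sqrt 2" "of_int k * sqrt 2 < (of_int j + 1) * sqrt 2"
        using that unfolding h by (simp_all add: algebra_simps)
      then have "real_of_int j < of_int k + 1" "real_of_int k < of_int j + 1" by simp_all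
      then show ?thesis by linarith
    qed
    show ?thesis unfolding rosen_digit_def by (rule theI[where a = k]) (use ex uniq in blast)+
  qed
  then show ?thesis
    using x_not_half_integer by unfold_locales (simp_all add: rosen_a_def)
qed

lemma dual_rosen_expansion_dual_rosen:
  assumes "ereal \<alpha> \<notin> Q_H4"
  shows "dual_rosen_expansion \<alpha> (dual_rosen_a \<alpha>) (dual_rosen_eps \<alpha>) (dual_rosen_x \<alpha>)"
proof -
  interpret sqrt2_expansion \<alpha> "dual_rosen_a \<alpha>" "dual_rosen_eps \<alpha>" "dual_rosen_x \<alpha>"
    by unfold_locales (simp_all add: assms dual_rosen_a_def dual_rosen_eps_def)
  have "(of_int (dual_rosen_digit y) - 1) * sqrt 2 + 1 \<le> y \<and> y < of_int (dual_rosen_digit y) * sqrt 2 + 1" for y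
  proof -
    define k where "k = \<lfloor>(y - 1) / sqrt 2\<rfloor> + 1"
    have "of_int k - 1 \<le> (y - 1) / sqrt 2" "(y - 1) / sqrt 2 < of_int k" unfolding k_def by linarith+
    then have ex: "(of_int k - 1) * sqrt 2 + 1 \<le> y \<and> y < of_int k * sqrt 2 + 1"
      by (simp_all add: field_simps)
    have uniq: "j = k" if "(of_int j - 1) * sqrt 2 + 1 \<le> y \<and> y < of_int j * sqrt 2 + 1"
      "(of_int k - 1) * sqrt 2 + 1 \<le> y \<and> y < of_int k * sqrt 2 + 1" for j k :: int
    proof -
      have "(of_int j - 1) * sqrt 2 < of_int k * sqrt 2" "(of_int k - 1) * sqrt 2 < of_int j * sqrt 2"
        using that by linarith+
      then have "real_of_int j - 1 < of_int k" "real_of_int k - 1 < of_int j" by simp_all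
      then show ?thesis by linarith
    qed
    show ?thesis unfolding dual_rosen_digit_def by (rule theI[where a = k]) (use ex uniq in blast)+
  qed
  then show ?thesis
    by unfold_locales (simp_all add: dual_rosen_a_def)
qed

section \<open>Incompatibility of the two exceptional columns\<close>

text \<open>\<open>(m, n)\<close> are the coordinates of a dual convergent with respect to two Rosen
  columns, and \<open>T - sqrt 2 * S\<close> is the denominator of the common candidate. The
  determinant condition writes that convergent as a sign \<open>\<delta>\<close> times the older
  column plus \<open>c * sqrt 2\<close> times the candidate, with \<open>c\<close> an integer. The
  bounds \<open>s\<close> on its denominator force \<open>c = 1\<close> and
  \<open>\<delta> = -1\<close>, and then its error is too large.\<close>

lemma no_common_intermediate:
  fixes m n S T x eT :: real
  assumes L: "hecke_pair m n" and det: "\<bar>m + sqrt 2 * n\<bar> = 1"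
    and S: "0 < S" "(sqrt 2 + 1) * S < T" and x: "sqrt 2 < x" and eT: "eT \<noteq> 0"
    and s: "T - sqrt 2 * S < m * S + n * T" "m * S + n * T \<le> sqrt 2 * (T - sqrt 2 * S)"
    and err: "\<bar>m * (x * eT) + n * eT\<bar> \<le> \<bar>eT - sqrt 2 * (x * eT)\<bar>"
  shows False
proof -
  note w = sqrt2_bounds
  obtain c :: int where c: "n = sqrt 2 * of_int c"
  proof -
    obtain a c :: int where "n = sqrt 2 * of_int c \<or> m = sqrt 2 * of_int a \<and> n = of_int c"
      using L unfolding hecke_pair_def by blast
    then show ?thesis
    proof
      assume "m = sqrt 2 * of_int a \<and> n = of_int c"
      \<comment> \<open>In the other parity the determinant would be \<open>sqrt 2\<close> times an
        integer, whose square is even.\<close>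
      then have "m + sqrt 2 * n = sqrt 2 * of_int (a + c)" by (simp add: algebra_simps)
      then have "(sqrt 2 * of_int (a + c))\<^sup>2 = 1" using det by (simp add: abs_square_eq_1)
      then have "real_of_int (2 * (a + c)\<^sup>2) = 1" by (simp add: power_mult_distrib)
      then have "2 * (a + c)\<^sup>2 = 1" by linarith
      moreover have "2 * i \<noteq> 1" for i :: int by presburger
      ultimately show ?thesis by blast
    qed (rule that)
  qed
  define V where "V = T - sqrt 2 * S"
  have SV: "S < V" using S(2) by (simp add: V_def algebra_simps)
  obtain \<delta> where \<delta>: "m = \<delta> - sqrt 2 * n" "\<delta> = 1 \<or> \<delta> = -1" using det by (metis abs_eq_iff' abs_1 add_diff_cancel_right')
  have eq: "m * S + n * T = \<delta> * S + of_int c * (sqrt 2 * V)"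
    by (simp add: \<delta>(1) c V_def algebra_simps)
  have s': "V < \<delta> * S + of_int c * (sqrt 2 * V)" "\<delta> * S + of_int c * (sqrt 2 * V) \<le> sqrt 2 * V"
    using s unfolding eq V_def by auto
  have \<delta>S: "\<delta> * S \<le> S" "\<delta> * S \<ge> - S" using \<delta>(2) S by auto
  have V: "0 < V" "1 * V < sqrt 2 * V" using SV S by (simp, intro mult_strict_right_mono, auto)
  have c1: "c = 1"
  proof (rule ccontr)
    assume "c \<noteq> 1"
    then consider "c \<le> 0" | "c \<ge> 2" by linarith
    then show False
    proof cases
      case 1
      then have "of_int c * (sqrt 2 * V) \<le> of_int 0 * (sqrt 2 * V)" using V by (intro mult_right_mono) auto
      then show ?thesis using s' \<delta>S SV by simp
    next
      case 2
      then have "of_int 2 * (sqrt 2 * V) \<le> of_int c * (sqrt 2 * V)" using V by (intro mult_right_mono) auto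
      then have "2 * (sqrt 2 * V) \<le> of_int c * (sqrt 2 * V)" by (simp only: of_int_numeral)
      then show ?thesis using s' \<delta>S SV V by linarith
    qed
  qed
  then have "\<delta> = -1" using s'(2) S \<delta>(2) by auto
  \<comment> \<open>Here \<open>-3\<close> is \<open>-1 - sqrt 2 * sqrt 2\<close>. For
    \<open>x > sqrt 2\<close> the error \<open>3 * x - sqrt 2\<close> exceeds
    \<open>sqrt 2 * x - 1\<close>.\<close>
  then have mn: "m = -3" "n = sqrt 2" using \<delta>(1) c c1 by simp_all
  have "\<bar>sqrt 2 - 3 * x\<bar> * \<bar>eT\<bar> \<le> \<bar>1 - sqrt 2 * x\<bar> * \<bar>eT\<bar>"
    using err unfolding mn abs_mult[symmetric] by (simp add: algebra_simps)
  then have *: "\<bar>sqrt 2 - 3 * x\<bar> \<le> \<bar>1 - sqrt 2 * x\<bar>" using eT by simp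
  have "sqrt 2 * x < 2 * x" using x w by (intro mult_strict_right_mono) auto
  moreover have "1 * x < sqrt 2 * x" using x w by (intro mult_strict_right_mono) auto
  ultimately show False using * x w by linarith
qed

theorem theorem1p4:
  fixes \<alpha> p q :: real
  assumes "ereal \<alpha> \<notin> Q_H4"
    and "H4_fraction p q"
  shows "H4_best_approximation \<alpha> p q \<longleftrightarrow>
    (\<exists>i. p / q = rosen_convergent \<alpha> i) \<or>
    (\<exists>i\<ge>1. p / q = dual_rosen_convergent \<alpha> i)"
proof -
  interpret R: rosen_expansion \<alpha> "rosen_a \<alpha>" "rosen_eps \<alpha>" "rosen_x \<alpha>"
    by (rule rosen_expansion_rosen) fact
  interpret D: dual_rosen_expansion \<alpha> "dual_rosen_a \<alpha>" "dual_rosen_eps \<alpha>" "dual_rosen_x \<alpha>"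
    by (rule dual_rosen_expansion_dual_rosen) fact
  have rosen: "rosen_convergent \<alpha> i = R.num (Suc i) / R.den (Suc i)" for i
    unfolding rosen_convergent_def by (rule rosen_cfrac[OF R.rule])
  have dual: "dual_rosen_convergent \<alpha> i = D.num (Suc i) / D.den (Suc i)" for i
    unfolding dual_rosen_convergent_def by (rule dual_rosen_cfrac[OF D.rule])
  show ?thesis
  proof
    assume "(\<exists>i. p / q = rosen_convergent \<alpha> i) \<or> (\<exists>i\<ge>1. p / q = dual_rosen_convergent \<alpha> i)"
    then show "H4_best_approximation \<alpha> p q"
    proof
      assume "\<exists>i. p / q = rosen_convergent \<alpha> i"
      then obtain i where "p / q = rosen_convergent \<alpha> i" by blast
      then show ?thesis unfolding rosen by (rule R.best_approximation[OF assms(2)])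
    next
      assume "\<exists>i\<ge>1. p / q = dual_rosen_convergent \<alpha> i"
      then obtain i where "p / q = dual_rosen_convergent \<alpha> (Suc i)" by (metis Suc_le_D One_nat_def)
      then show ?thesis unfolding dual by (rule D.best_approximation[OF assms(2)])
    qed
  next
    assume best: "H4_best_approximation \<alpha> p q"
    show "(\<exists>i. p / q = rosen_convergent \<alpha> i) \<or> (\<exists>i\<ge>1. p / q = dual_rosen_convergent \<alpha> i)"
    proof (rule ccontr)
      assume none: "\<not> ?thesis"
      have "p / q \<noteq> R.num (Suc i) / R.den (Suc i)" for i using none rosen by metis
      then obtain k where k: "p = R.num (Suc (Suc k)) - sqrt 2 * R.num (Suc k)"
        "q = R.den (Suc (Suc k)) - sqrt 2 * R.den (Suc k)" "rosen_eps \<alpha> (Suc (Suc k)) = -1" "q > 1"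
        by (rule R.non_convergent_best_approximation[OF best]) blast
      \<comment> \<open>Index 0 is not covered by \<open>none\<close>; comparing denominators
        excludes it, 1 against \<open>q > 1\<close>.\<close>
      have "p / q \<noteq> D.num (Suc i) / D.den (Suc i)" for i
      proof (cases i)
        case 0
        then show ?thesis using D.fraction_unique[OF assms(2), of 0] \<open>q > 1\<close> by auto
      next
        case (Suc j)
        then have "i \<ge> 1" by simp
        then show ?thesis using none unfolding dual by blast
      qed
      then obtain j where j: "p = sqrt 2 * D.num (Suc (Suc j)) - D.num (Suc j)"
        "q = sqrt 2 * D.den (Suc (Suc j)) - D.den (Suc j)" "dual_rosen_eps \<alpha> (Suc (Suc j)) = -1"
        "D.den (Suc (Suc j)) < (sqrt 2 + 1) * D.den (Suc j)"
        by (rule D.non_convergent_best_approximation[OF best]) blast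
      let ?P = "D.num (Suc (Suc j))" and ?Q = "D.den (Suc (Suc j))"
      let ?S = "R.den (Suc k)" and ?T = "R.den (Suc (Suc k))"
      let ?x = "rosen_x \<alpha> (Suc (Suc k))" and ?y = "dual_rosen_x \<alpha> (Suc (Suc j))"
      obtain m n where mn: "?P = m * R.num (Suc k) + n * R.num (Suc (Suc k))" "?Q = m * ?S + n * ?T" "hecke_pair m n"
        by (rule R.coordinates[OF D.column[of "Suc (Suc j)"], where k = "Suc k"]) blast
      have "?P * q - ?Q * p = - (?P * D.den (Suc j) - ?Q * D.num (Suc j))"
        by (simp add: j(1,2) algebra_simps del: cf_num.simps cf_den.simps)
      then have "\<bar>?P * q - ?Q * p\<bar> = 1" using D.det[of "Suc j"] by simp
      moreover have "?P * q - ?Q * p = - (m + sqrt 2 * n) * (R.num (Suc (Suc k)) * ?S - ?T * R.num (Suc k))"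
        by (simp add: mn k(1,2) algebra_simps del: cf_num.simps cf_den.simps)
      ultimately have det: "\<bar>m + sqrt 2 * n\<bar> = 1"
        using R.det[of "Suc k"] by (simp add: abs_mult del: cf_num.simps cf_den.simps)
      have errR: "R.err (Suc k) = ?x * R.err (Suc (Suc k))"
        using R.err_prev[of "Suc k"] k(3) by simp
      have errD: "D.err (Suc j) = ?y * D.err (Suc (Suc j))"
        using D.err_prev[of "Suc j"] j(3) by simp
      have eV: "q * \<alpha> - p = R.err (Suc (Suc k)) - sqrt 2 * (?x * R.err (Suc (Suc k)))"
        unfolding errR[symmetric] by (simp add: k(1,2) R.err_def algebra_simps del: cf_num.simps cf_den.simps)
      have eV': "q * \<alpha> - p = (sqrt 2 - ?y) * D.err (Suc (Suc j))"
        unfolding left_diff_distrib errD[symmetric]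
        by (simp add: j(1,2) D.err_def algebra_simps del: cf_num.simps cf_den.simps)
      have eB: "D.err (Suc (Suc j)) = m * (?x * R.err (Suc (Suc k))) + n * R.err (Suc (Suc k))"
        unfolding errR[symmetric] by (simp add: mn D.err_def R.err_def algebra_simps del: cf_num.simps cf_den.simps)
      \<comment> \<open>By \<open>x_ge\<close> the factor relating the two errors has size at least
        \<open>sqrt 2 + 1 - sqrt 2 = 1\<close>.\<close>
      have "1 * \<bar>D.err (Suc (Suc j))\<bar> \<le> \<bar>sqrt 2 - ?y\<bar> * \<bar>D.err (Suc (Suc j))\<bar>"
        using D.x_ge[OF j(3)] by (intro mult_right_mono) auto
      then have err: "\<bar>m * (?x * R.err (Suc (Suc k))) + n * R.err (Suc (Suc k))\<bar>
          \<le> \<bar>R.err (Suc (Suc k)) - sqrt 2 * (?x * R.err (Suc (Suc k)))\<bar>"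
        unfolding eV[symmetric] eV' eB[symmetric] abs_mult by simp
      \<comment> \<open>The ratio bound on the dual denominators places \<open>q\<close> strictly
        below \<open>?Q\<close>; in the other direction \<open>den_growth\<close> gives
        \<open>?Q \<le> sqrt 2 * q\<close>.\<close>
      have "(sqrt 2 - 1) * ?Q < (sqrt 2 - 1) * ((sqrt 2 + 1) * D.den (Suc j))"
        using j(4) sqrt2_bounds by (intro mult_strict_left_mono) auto
      moreover have "(sqrt 2 - 1) * ((sqrt 2 + 1) * D.den (Suc j)) = D.den (Suc j)"
        by (simp add: algebra_simps)
      ultimately have "(sqrt 2 - 1) * ?Q < D.den (Suc j)" by (simp only:)
      then have s1: "?T - sqrt 2 * ?S < m * ?S + n * ?T"
        unfolding mn(2)[symmetric] k(2)[symmetric] j(2) by (simp add: algebra_simps del: cf_num.simps cf_den.simps)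
      have "sqrt 2 * (sqrt 2 * ?Q - D.den (Suc j)) = 2 * ?Q - sqrt 2 * D.den (Suc j)"
        by (simp add: right_diff_distrib mult.assoc[symmetric] del: cf_den.simps)
      then have s2: "m * ?S + n * ?T \<le> sqrt 2 * (?T - sqrt 2 * ?S)"
        unfolding mn(2)[symmetric] k(2)[symmetric] j(2) using D.den_growth(3)[of "Suc j"] by linarith
      show False
        by (rule no_common_intermediate[OF mn(3) det R.den_pos R.den_growth(3)[OF k(3)] R.x_gt R.err_nonzero s1 s2 err])
    qed
  qed
qed

end
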